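(* Let $J$ be an ideal quasimetric on a nonempty set $X$. Then $d_J$ is a metric on $X$. Moreover, if $D_J(x,y)<\infty$ for every $x,y\in X$, then $D_J$ also defines a metric on $X$.
   Context: A quasimetric on a nonempty set $X$ is a function $J:X\times X\to\mathbb{R}$ such that for all $x,y,z\in X$: (1) $J(x,y)\ge 0$; (2) $J(x,y)=0$ iff $x=y$; (3) $J(x,y)=J(y,x)$; (4) $J(x,y)\le\sigma[J(x,z)+J(z,y)]$ for some constant $\sigma\ge1$ independent of $x,y,z$. The quasimetric $J$ is ideal if there is $\sigma\ge1$ such that $J(x_1,x_{n+1})\le\sigma\sum_{i=1}^nJ(x_i,x_{i+1})$ for every $n$ and all $x_1,\dots,x_{n+1}\in X$. For $x,y\in X$, $d_J(x,y)$ is the infimum of $\sum_{i=1}^{n-1}J(x_i,x_{i+1})$ over all finite sequences $x_1,\dots,x_n\in X$ with $x_1=x$, $x_n=y$. A map $f:[a,b]\to(X,J)$ is continuous if $J(f(t_n),f(t))\to0$ whenever $t_n\to t$. For $N\in\mathbb{N}$, $\mathcal{P}_N([a,b],(X,J))$ is the set of continuous $f:[a,b]\to(X,J)$ for which there is a partition $a=a_0<a_1<\cdots<a_N=b$ such that for each $i=0,\dots,N-1$: (i) $J$ is a metric on the subset $f([a_i,a_{i+1}])$ (i.e. satisfies the triangle inequality there), and (ii) $f$ restricted to $[a_i,a_{i+1}]$ is Lipschitz, i.e. $J(f(s),f(t))\le C|s-t|$ for some constant $C$. For such $f$ the length is $L_J(f)=\int_a^b|\dot f(t)|_J\,dt$,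 where $|\dot f(t)|_J=\lim_{s\to t}J(f(s),f(t))/|s-t|$ (this limit exists for almost every $t$). For $x,y\in X$ let $Path_N(x,y)=\{f\in\mathcal{P}_N([0,1],(X,J)):f(0)=x,\ f(1)=y\}$, $D_J^{(N)}(x,y)=\inf\{L_J(f):f\in Path_N(x,y)\}$ (equal to $+\infty$ if $Path_N(x,y)$ is empty), and $D_J(x,y)=\lim_{N\to\infty}D_J^{(N)}(x,y)$ (the sequence is nonincreasing in $N$). *)

theory Defs
  imports "HOL-Analysis.Analysis"
begin

text \<open>
  The locale \<^locale>\<open>Metric_space\<close> also asks for nonnegativity and symmetry outside its carrier.
  A function that is only meaningful on \<open>S\<close> is therefore cut off outside \<open>S \<times> S\<close>.
\<close>

definition metric_on :: "'a set \<Rightarrow> ('a \<Rightarrow> 'a \<Rightarrow> real) \<Rightarrow> bool" where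
  "metric_on S d \<longleftrightarrow> Metric_space S (\<lambda>x y. if x \<in> S \<and> y \<in> S then d x y else 0)"

definition quasimetric_on :: "'a set \<Rightarrow> ('a \<Rightarrow> 'a \<Rightarrow> real) \<Rightarrow> bool" where
  "quasimetric_on X J \<longleftrightarrow>
     (\<forall>x\<in>X. \<forall>y\<in>X. 0 \<le> J x y) \<and>
     (\<forall>x\<in>X. \<forall>y\<in>X. J x y = 0 \<longleftrightarrow> x = y) \<and>
     (\<forall>x\<in>X. \<forall>y\<in>X. J x y = J y x) \<and>
     (\<exists>\<sigma>\<ge>1. \<forall>x\<in>X. \<forall>y\<in>X. \<forall>z\<in>X. J x y \<le> \<sigma> * (J x z + J z y))"

definition ideal_quasimetric_on :: "'a set \<Rightarrow> ('a \<Rightarrow> 'a \<Rightarrow> real) \<Rightarrow> bool" where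
  "ideal_quasimetric_on X J \<longleftrightarrow> quasimetric_on X J \<and>
     (\<exists>\<sigma>\<ge>1. \<forall>n\<ge>1. \<forall>x :: nat \<Rightarrow> 'a. (\<forall>i\<in>{1..n+1}. x i \<in> X) \<longrightarrow>
        J (x 1) (x (n+1)) \<le> \<sigma> * (\<Sum>i=1..n. J (x i) (x (i+1))))"

definition chain_dist :: "'a set \<Rightarrow> ('a \<Rightarrow> 'a \<Rightarrow> real) \<Rightarrow> 'a \<Rightarrow> 'a \<Rightarrow> real" where
  "chain_dist X J x y =
     Inf {(\<Sum>i=1..<n. J (c i) (c (i+1))) | (n :: nat) (c :: nat \<Rightarrow> 'a).
            1 \<le> n \<and> (\<forall>i\<in>{1..n}. c i \<in> X) \<and> c 1 = x \<and> c n = y}"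

text \<open>
  A map on \<open>[a,b]\<close> is represented by a total function on the reals; none of the notions below
  depends on its values outside \<open>[a,b]\<close>.
\<close>

definition quasi_continuous :: "('a \<Rightarrow> 'a \<Rightarrow> real) \<Rightarrow> real \<Rightarrow> real \<Rightarrow> (real \<Rightarrow> 'a) \<Rightarrow> bool" where
  "quasi_continuous J a b f \<longleftrightarrow>
     (\<forall>t\<in>{a..b}. \<forall>u :: nat \<Rightarrow> real. (\<forall>n. u n \<in> {a..b}) \<and> u \<longlonglongrightarrow> t \<longrightarrow>
        (\<lambda>n. J (f (u n)) (f t)) \<longlonglongrightarrow> 0)"

definition pw_lipschitz_maps ::
    "'a set \<Rightarrow> ('a \<Rightarrow> 'a \<Rightarrow> real) \<Rightarrow> real \<Rightarrow> real \<Rightarrow> nat \<Rightarrow> (real \<Rightarrow> 'a) set" where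
  "pw_lipschitz_maps X J a b N =
     {f. f ` {a..b} \<subseteq> X \<and> quasi_continuous J a b f \<and>
         (\<exists>p :: nat \<Rightarrow> real. p 0 = a \<and> p N = b \<and> (\<forall>i<N. p i < p (Suc i)) \<and>
            (\<forall>i<N. metric_on (f ` {p i..p (Suc i)}) J \<and>
               (\<exists>C. \<forall>s\<in>{p i..p (Suc i)}. \<forall>t\<in>{p i..p (Suc i)}.
                  J (f s) (f t) \<le> C * \<bar>s - t\<bar>)))}"

text \<open>
  For the maps above, the limit defining the speed exists for almost every \<open>t\<close>. Elsewhere the
  value is unspecified; the length integrates over the completed measure \<^const>\<open>lebesgue\<close>, so
  these values are irrelevant.
\<close>

definition metric_speed ::
    "('a \<Rightarrow> 'a \<Rightarrow> real) \<Rightarrow> real \<Rightarrow> real \<Rightarrow> (real \<Rightarrow> 'a) \<Rightarrow> real \<Rightarrow> real" where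
  "metric_speed J a b f t = Lim (at t within {a..b}) (\<lambda>s. J (f s) (f t) / \<bar>s - t\<bar>)"

definition path_len ::
    "('a \<Rightarrow> 'a \<Rightarrow> real) \<Rightarrow> real \<Rightarrow> real \<Rightarrow> (real \<Rightarrow> 'a) \<Rightarrow> ennreal" where
  "path_len J a b f = (\<integral>\<^sup>+t\<in>{a..b}. ennreal (metric_speed J a b f t) \<partial>lebesgue)"

definition paths_between ::
    "'a set \<Rightarrow> ('a \<Rightarrow> 'a \<Rightarrow> real) \<Rightarrow> nat \<Rightarrow> 'a \<Rightarrow> 'a \<Rightarrow> (real \<Rightarrow> 'a) set" where
  "paths_between X J N x y = {f \<in> pw_lipschitz_maps X J 0 1 N. f 0 = x \<and> f 1 = y}"

text \<open>In \<^typ>\<open>ennreal\<close> the infimum of the empty set is \<open>\<infinity>\<close>.\<close>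

definition path_dist_N ::
    "'a set \<Rightarrow> ('a \<Rightarrow> 'a \<Rightarrow> real) \<Rightarrow> nat \<Rightarrow> 'a \<Rightarrow> 'a \<Rightarrow> ennreal" where
  "path_dist_N X J N x y = (INF f\<in>paths_between X J N x y. path_len J 0 1 f)"

definition path_dist :: "'a set \<Rightarrow> ('a \<Rightarrow> 'a \<Rightarrow> real) \<Rightarrow> 'a \<Rightarrow> 'a \<Rightarrow> ennreal" where
  "path_dist X J x y = lim (\<lambda>N. path_dist_N X J N x y)"

end

theory Submission imports Defs begin

text \<open>
  For an ideal quasimetric, \<open>J \<le> \<sigma> d\<^sub>J\<close>, so \<open>d\<^sub>J\<close> separates points. For \<open>D\<^sub>J\<close> the key is
  \<open>d\<^sub>J \<le> D\<^sub>J\<close>: on each piece of a path, \<open>J\<close> is a metric and the path is Lipschitz, so the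
  distance of the endpoints is at most the integral of the speed. This rests on the almost
  everywhere existence of the metric derivative of a Lipschitz curve \<open>f\<close>. The functions
  \<open>s \<mapsto> J (f s) (f q)\<close>, \<open>q\<close> rational, are Lipschitz, hence by Radon--Nikodym indefinite
  integrals of bounded densities \<open>h\<^sub>q\<close>; by Lebesgue differentiation (Henstock's lemma and a
  Vitali covering) the limit defining the speed exists and equals \<open>sup\<^sub>q \<bar>h\<^sub>q\<bar>\<close> almost everywhere.
  The triangle inequality for \<open>D\<^sub>J\<close> comes from concatenating paths, and its symmetry from
  reversing them; the length is invariant under affine changes of the parameter.
\<close>

subsection \<open>Differentiation of Lipschitz functions\<close>

text \<open>Each \<open>t\<close> in \<open>S\<close> is an endpoint of arbitrarily short intervals
  on which the error of the linear approximation with slope \<open>h t\<close> is at least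
  \<open>q\<close> times their length. A Vitali covering selects disjoint intervals of this kind
  that exhaust \<open>S\<close> up to a null set. Henstock's lemma bounds the total error of every
  finite subfamily by \<open>e * q\<close>, hence its total length by \<open>e\<close>.\<close>

lemma negligible_oscillation_set:
  fixes h F :: "real \<Rightarrow> real" and a b :: real
  assumes F: "\<And>s t. s \<le> t \<Longrightarrow> (h has_integral (F t - F s)) {s..t}"
    and "0 < q"
  defines "S \<equiv> {t\<in>{a<..<b}. \<forall>d>0. \<exists>s. s \<noteq> t \<and> \<bar>s - t\<bar> < d \<and>
                   q * \<bar>s - t\<bar> \<le> \<bar>F s - F t - h t * (s - t)\<bar>}"
  shows "negligible S"
proof -
  have "\<exists>T. S \<subseteq> T \<and> T \<in> lmeasurable \<and> measure lebesgue T \<le> e" if "e > 0" for e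
  proof -
    have eq: "e * q > 0"
      using that \<open>0 < q\<close> by simp
    have int: "h integrable_on cbox a b"
    proof (cases "a \<le> b")
      case True
      then show ?thesis using F[of a b] by (auto simp: integrable_on_def)
    qed (simp add: integrable_on_empty)
    obtain \<gamma> where \<gamma>: "gauge \<gamma>"
      and fine: "\<And>p. \<lbrakk>p tagged_partial_division_of (cbox a b); \<gamma> fine p\<rbrakk> \<Longrightarrow>
             sum (\<lambda>(x,k). norm(measure lborel k *\<^sub>R h x - integral k h)) p < e * q"
      by (rule Henstock_lemma[OF int eq]) (rule that)
    \<comment> \<open>An index is a pair (t, s): the tag \<open>t\<close> and the other endpoint
      \<open>s\<close>. The interval between them is written by midpoint and radius, the form that
      the Vitali theorem for closed balls takes.\<close>
    define c where "c = (\<lambda>i::real \<times> real. (fst i + snd i) / 2)"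
    define r where "r = (\<lambda>i::real \<times> real. \<bar>snd i - fst i\<bar> / 2)"
    define B where "B = (\<lambda>i. cball (c i) (r i))"
    define K where "K = {i. fst i \<in> S \<and> snd i \<noteq> fst i \<and> B i \<subseteq> \<gamma> (fst i) \<inter> {a..b} \<and>
        q * \<bar>snd i - fst i\<bar> \<le> \<bar>F (snd i) - F (fst i) - h (fst i) * (snd i - fst i)\<bar>}"
    have Bint: "B i = {min (fst i) (snd i)..max (fst i) (snd i)}" for i
      unfolding B_def c_def r_def cball_eq_atLeastAtMost
      by (auto simp: field_simps abs_if min_def max_def)
    have Beq: "cball (c i) (r i) = B i" for i
      by (simp add: B_def)
    have cover: "\<exists>i. i \<in> K \<and> x \<in> cball (c i) (r i) \<and> r i < d" if "x \<in> S" "0 < d" for x d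
    proof -
      have "x \<in> {a<..<b}" using that by (auto simp: S_def)
      then have "open (\<gamma> x \<inter> {a<..<b})" "x \<in> \<gamma> x \<inter> {a<..<b}"
        using \<gamma> by (auto simp: gauge_def)
      then obtain \<epsilon> where \<epsilon>: "\<epsilon> > 0" "ball x \<epsilon> \<subseteq> \<gamma> x \<inter> {a<..<b}"
        using openE by blast
      have "min \<epsilon> d > 0" using \<epsilon>(1) that by simp
      moreover have "\<forall>d>0. \<exists>s. s \<noteq> x \<and> \<bar>s - x\<bar> < d \<and>
          q * \<bar>s - x\<bar> \<le> \<bar>F s - F x - h x * (s - x)\<bar>"
        using that(1) by (simp add: S_def)
      ultimately obtain s where s: "s \<noteq> x" "\<bar>s - x\<bar> < min \<epsilon> d"
         "q * \<bar>s - x\<bar> \<le> \<bar>F s - F x - h x * (s - x)\<bar>"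
        by metis
      have "B (x, s) \<subseteq> ball x \<epsilon>"
        using s(2) by (auto simp: Bint dist_real_def)
      moreover have "\<gamma> x \<inter> {a<..<b} \<subseteq> \<gamma> x \<inter> {a..b}" by auto
      ultimately have "B (x, s) \<subseteq> \<gamma> x \<inter> {a..b}" using \<epsilon>(2) by blast
      then have "(x, s) \<in> K"
        using s \<open>x \<in> S\<close> by (simp add: K_def)
      moreover have "x \<in> cball (c (x,s)) (r (x,s))"
        using Bint[of "(x,s)"] unfolding B_def by auto
      moreover have "r (x,s) < d"
        using s(1,2) that by (simp add: r_def)
      ultimately show ?thesis by blast
    qed
    have rpos: "0 < r i" if "i \<in> K" for i
      using that by (auto simp: K_def r_def)
    obtain C where C: "countable C" "C \<subseteq> K"
      "pairwise (\<lambda>i j. disjnt (B i) (B j)) C" "negligible (S - (\<Union>i\<in>C. B i))"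
      by (rule Vitali_covering_theorem_cballs[of K r S c, OF rpos cover, unfolded Beq];
          (assumption | (rule that; assumption)))
    have bound: "measure lebesgue (\<Union>i\<in>D. B i) \<le> e" if D: "D \<subseteq> C" "finite D" for D
    proof -
      \<comment> \<open>Distinct members of \<open>D\<close> have disjoint nonempty intervals, so
        passing from indices to tagged intervals loses no term of the sum.\<close>
      have inj: "inj_on (\<lambda>i. (fst i, B i)) D"
      proof (rule inj_onI)
        fix i j assume ij: "i \<in> D" "j \<in> D" "(fst i, B i) = (fst j, B j)"
        have "B i \<noteq> {}" by (simp add: Bint)
        then have "B i \<inter> B j \<noteq> {}" using ij(3) by simp
        then show "i = j"
          using ij(1,2) D(1) pairwiseD[OF C(3), of i j] unfolding disjnt_def by blast
      qed
      define p where "p = (\<lambda>i. (fst i, B i)) ` D"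
      have p: "p tagged_partial_division_of cbox a b"
        unfolding tagged_partial_division_of_def
      proof (intro conjI allI impI)
        show "finite p" using D by (simp add: p_def)
        fix x k assume "(x, k) \<in> p"
        then obtain i where i: "i \<in> D" "x = fst i" "k = B i" by (auto simp: p_def)
        then have "i \<in> K" using D C by auto
        then show "x \<in> k" "k \<subseteq> cbox a b" "\<exists>a b. k = cbox a b"
          using i by (auto simp: K_def Bint)
      next
        fix x k y l assume A: "(x, k) \<in> p \<and> (y, l) \<in> p \<and> (x, k) \<noteq> (y, l)"
        then obtain i j where i: "i \<in> D" "x = fst i" "k = B i" and j: "j \<in> D" "y = fst j" "l = B j"
          by (auto simp: p_def)
        have "i \<noteq> j" using A i j by auto
        then have "B i \<inter> B j = {}"
          using i(1) j(1) D(1) pairwiseD[OF C(3), of i j] unfolding disjnt_def by blast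
        then show "interior k \<inter> interior l = {}"
          using i(3) j(3) interior_subset[of k] interior_subset[of l] by blast
      qed
      moreover have "\<gamma> fine p"
        using D C by (auto simp: fine_def p_def K_def)
      ultimately have less: "(\<Sum>(x,k)\<in>p. norm(measure lborel k *\<^sub>R h x - integral k h)) < e * q"
        by (rule fine)
      \<comment> \<open>The tag is the left or the right endpoint of its interval according to the
        order of \<open>t\<close> and \<open>s\<close>; only the sign inside the norm
        differs.\<close>
      have osc: "q * measure lebesgue (B i) \<le> norm (measure lborel (B i) *\<^sub>R h (fst i) - integral (B i) h)"
        if "i \<in> D" for i
      proof -
        have i: "i \<in> K" using that D C by auto
        obtain t s where [simp]: "i = (t, s)" by fastforce
        have ts: "q * \<bar>s - t\<bar> \<le> \<bar>F s - F t - h t * (s - t)\<bar>"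
          using i by (auto simp: K_def)
        show ?thesis
        proof (cases "t \<le> s")
          case True
          then have [simp]: "B (t, s) = {t..s}" by (simp add: Bint)
          have "integral {t..s} h = F s - F t" using F[OF True] by (rule integral_unique)
          then have "measure lborel (B i) *\<^sub>R h (fst i) - integral (B i) h = - (F s - F t - h t * (s - t))"
            using True by (simp add: algebra_simps)
          then show ?thesis using ts True by (simp only: norm_minus_cancel real_norm_def) simp
        next
          case False
          then have [simp]: "B (t, s) = {s..t}" by (simp add: Bint)
          have "integral {s..t} h = F t - F s" using F[of s t] False by (simp add: integral_unique)
          then have "measure lborel (B i) *\<^sub>R h (fst i) - integral (B i) h = F s - F t - h t * (s - t)"
            using False by (simp add: algebra_simps)
          then show ?thesis using ts False by (simp only: real_norm_def) simp
        qed
      qed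
      have "q * (\<Sum>i\<in>D. measure lebesgue (B i)) \<le> (\<Sum>i\<in>D. norm (measure lborel (B i) *\<^sub>R h (fst i) - integral (B i) h))"
        unfolding sum_distrib_left by (intro sum_mono osc)
      also have "\<dots> = (\<Sum>(x,k)\<in>p. norm(measure lborel k *\<^sub>R h x - integral k h))"
        unfolding p_def by (subst sum.reindex[OF inj]) simp
      also have "\<dots> < e * q" by (rule less)
      finally have "(\<Sum>i\<in>D. measure lebesgue (B i)) < e"
        using \<open>0 < q\<close> by (simp add: mult.commute)
      moreover have "measure lebesgue (\<Union>i\<in>D. B i) \<le> (\<Sum>i\<in>D. measure lebesgue (B i))"
        using D by (intro measure_UNION_le) (auto simp: Bint)
      ultimately show ?thesis by simp
    qed
    \<comment> \<open>The bound is uniform over finite subfamilies, so it passes to the countable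
      union.\<close>
    have U: "(\<Union>i\<in>C. B i) \<in> lmeasurable" "measure lebesgue (\<Union>i\<in>C. B i) \<le> e"
      using fmeasurable_UN_bound[OF C(1) _ bound] measure_UN_bound[OF C(1) _ bound]
      by (simp_all add: Bint)
    show ?thesis
    proof (intro exI conjI)
      let ?T = "(\<Union>i\<in>C. B i) \<union> (S - (\<Union>i\<in>C. B i))"
      show "S \<subseteq> ?T" by blast
      show "?T \<in> lmeasurable"
        by (intro fmeasurable.Un U(1) negligible_imp_measurable[OF C(4)])
      have "S - (\<Union>i\<in>C. B i) \<in> null_sets lebesgue"
        using C(4) by (simp add: negligible_iff_null_sets)
      then show "measure lebesgue ?T \<le> e"
        using measure_Un_null_set[OF fmeasurableD[OF U(1)]] U(2) by metis
    qed
  qed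
  then show ?thesis unfolding negligible_outer_le by blast
qed

lemma has_real_derivative_indefinite_integral_AE:
  fixes h F :: "real \<Rightarrow> real"
  assumes F: "\<And>s t. s \<le> t \<Longrightarrow> (h has_integral (F t - F s)) {s..t}"
  shows "AE t in lebesgue. (F has_real_derivative h t) (at t)"
proof -
  \<comment> \<open>One index serves both as the window (-n, n) and as the threshold 1/(n+1): a
    point outside all \<open>S n\<close> may be tested with \<open>n\<close> as large as both
    require.\<close>
  define S where "S = (\<lambda>n::nat. {t\<in>{- real n<..<real n}. \<forall>d>0. \<exists>s. s \<noteq> t \<and> \<bar>s - t\<bar> < d \<and>
                   1 / Suc n * \<bar>s - t\<bar> \<le> \<bar>F s - F t - h t * (s - t)\<bar>})"
  have "negligible (S n)" for n
    unfolding S_def by (rule negligible_oscillation_set[OF F]) auto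
  then have neg: "negligible (\<Union>n. S n)"
    by (rule negligible_Union_nat)
  have der: "(F has_real_derivative h t) (at t)" if "t \<notin> (\<Union>n. S n)" for t
  proof -
    have "((\<lambda>s. (F s - F t) / (s - t)) \<longlongrightarrow> h t) (at t)"
      unfolding LIM_def
    proof (intro allI impI)
      fix e :: real assume "e > 0"
      obtain n1 where n1: "1 / Suc n1 < e"
        using \<open>e > 0\<close> nat_approx_posE by metis
      obtain n2 where n2: "\<bar>t\<bar> < real n2"
        using reals_Archimedean2 by blast
      define n where "n = max n1 n2"
      have "1 / Suc n \<le> 1 / Suc n1" by (simp add: n_def frac_le)
      then have ne: "1 / Suc n < e" using n1 by linarith
      have "t \<in> {- real n<..<real n}" using n2 by (auto simp: n_def)
      moreover have "t \<notin> S n" using that by auto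
      ultimately obtain d where d: "d > 0"
        and *: "\<And>s. s \<noteq> t \<Longrightarrow> \<bar>s - t\<bar> < d \<Longrightarrow> \<bar>F s - F t - h t * (s - t)\<bar> < 1 / Suc n * \<bar>s - t\<bar>"
        unfolding S_def by (smt (verit) mem_Collect_eq)
      show "\<exists>d>0. \<forall>s. s \<noteq> t \<and> dist s t < d \<longrightarrow> dist ((F s - F t) / (s - t)) (h t) < e"
      proof (intro exI[of _ d] conjI d allI impI)
        fix s assume s: "s \<noteq> t \<and> dist s t < d"
        have "(F s - F t) / (s - t) - h t = (F s - F t - h t * (s - t)) / (s - t)"
          using s by (simp add: field_simps)
        then have "dist ((F s - F t) / (s - t)) (h t) = \<bar>F s - F t - h t * (s - t)\<bar> / \<bar>s - t\<bar>"
          by (simp add: dist_real_def)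
        also have "\<dots> < 1 / Suc n"
          using *[of s] s by (simp add: dist_real_def field_simps)
        finally show "dist ((F s - F t) / (s - t)) (h t) < e" using ne by simp
      qed
    qed
    then show ?thesis by (simp add: has_field_derivative_iff)
  qed
  show ?thesis
    using neg der by (intro AE_I'[of "\<Union>n. S n"]) (auto simp: negligible_iff_null_sets)
qed

text \<open>The Stieltjes measure of an interval is at most \<open>C\<close> times its length. A
  null set is covered by nonoverlapping intervals of small total length, so its Stieltjes measure is
  small as well.\<close>

lemma absolutely_continuous_interval_measure:
  fixes G :: "real \<Rightarrow> real"
  assumes mono: "\<And>s t. s \<le> t \<Longrightarrow> G s \<le> G t"
    and lip: "\<And>s t. s \<le> t \<Longrightarrow> G t - G s \<le> C * (t - s)"
    and cont: "continuous_on UNIV G"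
  shows "absolutely_continuous lborel (interval_measure G)"
proof -
  let ?M = "interval_measure G"
  have C0: "0 \<le> C" using mono[of 0 1] lip[of 0 1] by simp
  have Icc: "emeasure ?M {s..t} = ennreal (G t - G s)" if "s \<le> t" for s t
    using emeasure_interval_measure_Icc[OF that mono cont] .
  have bdd: "emeasure ?M N = 0" if N: "N \<in> null_sets lborel" and sub: "N \<subseteq> cbox a b" for N a b
  proof -
    have "emeasure ?M N \<le> ennreal e" if "e > 0" for e
    proof -
      \<comment> \<open>Dividing by \<open>C + 1\<close> keeps the quotient meaningful for
        \<open>C = 0\<close>.\<close>
      define e' where "e' = e / (C + 1)"
      have e': "e' > 0" "C * e' \<le> e" using that C0 by (auto simp: e'_def field_simps)
      have Nl: "N \<in> lmeasurable" "measure lebesgue N = 0"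
        using N by (auto simp: fmeasurable_def null_sets_def measure_def emeasure_completion)
      obtain \<D> where D: "countable \<D>"
        and K: "\<And>K. K \<in> \<D> \<Longrightarrow> K \<subseteq> cbox a b \<and> K \<noteq> {} \<and> (\<exists>c d. K = cbox c d)"
        and pw: "pairwise (\<lambda>A B. interior A \<inter> interior B = {}) \<D>"
        and cov: "N \<subseteq> \<Union>\<D>" and lm: "\<Union>\<D> \<in> lmeasurable" and me: "measure lebesgue (\<Union>\<D>) \<le> 0 + e'"
        using measurable_outer_intervals_bounded[OF Nl(1) sub e'(1)] Nl(2) by metis
      have Kf: "K \<in> fmeasurable ?M" "measure ?M K \<le> C * measure lebesgue K" if K': "K \<in> \<D>" for K
      proof -
        obtain c d where cd: "K = {c..d}" "c \<le> d" using K[OF K'] by fastforce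
        show "K \<in> fmeasurable ?M" using cd Icc by (auto simp: fmeasurable_def)
        show "measure ?M K \<le> C * measure lebesgue K"
          using cd Icc[of c d] mono[of c d] lip[of c d] by (simp add: measure_def)
      qed
      have fin: "measure ?M (\<Union>\<E>) \<le> e" if E: "\<E> \<subseteq> \<D>" "finite \<E>" for \<E>
      proof -
        have "measure ?M (\<Union>\<E>) \<le> (\<Sum>K\<in>\<E>. measure ?M K)"
          using fmeasurableD[OF Kf(1)] E by (intro measure_Union_le) auto
        also have "\<dots> \<le> (\<Sum>K\<in>\<E>. C * measure lebesgue K)"
          using Kf E by (intro sum_mono) auto
        also have "\<dots> = C * (\<Sum>K\<in>\<E>. measure lebesgue K)" by (simp add: sum_distrib_left)
        \<comment> \<open>The covering intervals may share endpoints. Two of them meet in a convex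
          set with empty interior, which is negligible, so lengths still add up exactly.\<close>
        also have "(\<Sum>K\<in>\<E>. measure lebesgue K) = measure lebesgue (\<Union>\<E>)"
        proof (rule measure_negligible_finite_Union[symmetric])
          show "finite \<E>" by fact
          show "K \<in> lmeasurable" if "K \<in> \<E>" for K using K[of K] that E by auto
          show "pairwise (\<lambda>S T. negligible (S \<inter> T)) \<E>"
            unfolding pairwise_def
          proof (intro ballI impI)
            fix S T assume ST: "S \<in> \<E>" "T \<in> \<E>" "S \<noteq> T"
            then have "convex (S \<inter> T)" using K[of S] K[of T] E by (auto intro!: convex_Int)
            moreover have "interior (S \<inter> T) = {}"
              using pw ST E unfolding pairwise_def by (auto simp: interior_Int)
            ultimately show "negligible (S \<inter> T)" by (simp add: negligible_convex_interior)
          qed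
        qed
        also have "C * measure lebesgue (\<Union>\<E>) \<le> C * measure lebesgue (\<Union>\<D>)"
        proof -
          have "\<Union>\<E> \<in> sets lebesgue" using K E by (intro sets.finite_Union) (fastforce)+
          then show ?thesis
          using E lm C0 by (intro mult_left_mono measure_mono_fmeasurable) (auto simp: fmeasurableD)
        qed
        also have "\<dots> \<le> C * e'" using me C0 by (intro mult_left_mono) auto
        finally show ?thesis using e'(2) by simp
      qed
      have "\<Union>\<D> \<in> fmeasurable ?M" "measure ?M (\<Union>\<D>) \<le> e"
        using fmeasurable_UN_bound[of \<D> "\<lambda>x. x" ?M e] measure_UN_bound[of \<D> "\<lambda>x. x" ?M e] D Kf(1) fin
        by simp_all
      then have "emeasure ?M (\<Union>\<D>) \<le> ennreal e"
        by (simp add: emeasure_eq_measure2 ennreal_leI)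
      moreover have "emeasure ?M N \<le> emeasure ?M (\<Union>\<D>)"
        using cov \<open>\<Union>\<D> \<in> fmeasurable ?M\<close> by (intro emeasure_mono) (auto simp: fmeasurableD)
      ultimately show ?thesis by simp
    qed
    then show ?thesis
      by (metis ennreal_le_epsilon add_0 le_zero_eq)
  qed
  show ?thesis
    unfolding absolutely_continuous_def
  proof
    fix N assume N: "N \<in> null_sets (lborel::real measure)"
    \<comment> \<open>The covering argument is for bounded sets; a general null set is exhausted by
      its traces on [-n, n].\<close>
    have "emeasure ?M (\<Union>n::nat. N \<inter> cbox (- real n) (real n)) = 0"
    proof (rule emeasure_UN_eq_0)
      show "emeasure ?M (N \<inter> cbox (- real n) (real n)) = 0" for n
        using N by (intro bdd[where a="- real n" and b="real n"] null_set_Int2) auto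
      show "range (\<lambda>n::nat. N \<inter> cbox (- real n) (real n)) \<subseteq> sets ?M"
        using N by auto
    qed
    moreover have "(\<Union>n::nat. N \<inter> cbox (- real n) (real n)) = N"
    proof -
      have "\<exists>n::nat. - real n \<le> x \<and> x \<le> real n" for x :: real
        using real_arch_simple[of "\<bar>x\<bar>"] by (auto simp: abs_le_iff) (metis minus_le_iff)
      then show ?thesis by auto
    qed
    ultimately have "emeasure ?M N = 0" by metis
    then show "N \<in> null_sets ?M" using N by (intro null_setsI) auto
  qed
qed

text \<open>\<open>h\<close> is the Radon-Nikodym density of the Stieltjes measure of
  \<open>G\<close> with respect to Lebesgue measure.\<close>

lemma mono_lipschitz_indefinite_integral:
  fixes G :: "real \<Rightarrow> real"
  assumes mono: "\<And>s t. s \<le> t \<Longrightarrow> G s \<le> G t"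
    and lip: "\<And>s t. s \<le> t \<Longrightarrow> G t - G s \<le> C * (t - s)"
  obtains h where "h \<in> borel_measurable borel"
    "\<And>s t. s \<le> t \<Longrightarrow> (h has_integral (G t - G s)) {s..t}"
proof -
  let ?M = "interval_measure G"
  have "C-lipschitz_on UNIV G"
  proof (rule lipschitz_onI)
    show "0 \<le> C" using mono[of 0 1] lip[of 0 1] by simp
    show "dist (G x) (G y) \<le> C * dist x y" for x y
      using mono[of x y] mono[of y x] lip[of x y] lip[of y x]
      by (cases "x \<le> y") (auto simp: dist_real_def)
  qed
  then have cont: "continuous_on UNIV G" by (rule lipschitz_on_continuous_on)
  obtain f where f[measurable]: "f \<in> borel_measurable lborel" and fM: "density lborel f = ?M"
    using sigma_finite_measure.Radon_Nikodym[OF sigma_finite_lborel absolutely_continuous_interval_measure[OF mono lip cont]]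
    by auto
  have nn: "(\<integral>\<^sup>+x\<in>{s..t}. f x \<partial>lborel) = ennreal (G t - G s)" if "s \<le> t" for s t
    using emeasure_interval_measure_Icc[OF that mono cont] emeasure_density[of f lborel "{s..t}"]
    by (simp add: fM)
  \<comment> \<open>The density takes values in \<open>ennreal\<close>. Its integral over a bounded
    interval is finite, so it is finite almost everywhere and \<open>enn2real\<close> alters no
    integral.\<close>
  define h where "h = (\<lambda>x. enn2real (f x))"
  have hm[measurable]: "h \<in> borel_measurable borel" unfolding h_def by measurable
  have "(h has_integral (G t - G s)) {s..t}" if st: "s \<le> t" for s t
  proof -
    have "AE x in lborel. f x * indicator {s..t} x \<noteq> \<infinity>"
      by (rule nn_integral_noteq_infinite) (auto simp: nn[OF st])
    then have "AE x in lborel. ennreal (h x * indicator {s..t} x) = f x * indicator {s..t} x"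
      by eventually_elim (auto simp: h_def ennreal_enn2real_if split: split_indicator)
    then have "(\<integral>\<^sup>+x. ennreal (h x * indicator {s..t} x) \<partial>lborel) = ennreal (G t - G s)"
      using nn[OF st] nn_integral_cong_AE by metis
    then have "((\<lambda>x. h x * indicator {s..t} x) has_integral (G t - G s)) UNIV"
      using mono[OF st] by (intro nn_integral_has_integral) (auto simp: h_def)
    moreover have "(\<lambda>x. h x * indicator {s..t} x) = (\<lambda>x. if x \<in> {s..t} then h x else 0)"
      by auto
    ultimately show ?thesis
      using has_integral_restrict_UNIV[of "{s..t}" h "G t - G s"] by metis
  qed
  with hm show ?thesis by (rule that)
qed

text \<open>Adding \<open>C * t\<close> to \<open>F\<close> makes it nondecreasing, with Lipschitz
  constant \<open>2 * C\<close>, so the monotone case applies; subtracting \<open>C\<close> from the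
  density undoes the shift.\<close>

lemma lipschitz_indefinite_integral:
  fixes F :: "real \<Rightarrow> real"
  assumes lip: "\<And>s t. \<bar>F s - F t\<bar> \<le> C * \<bar>s - t\<bar>"
  shows "\<exists>h. h \<in> borel_measurable borel \<and> (\<forall>t. \<bar>h t\<bar> \<le> C) \<and>
    (\<forall>s t. s \<le> t \<longrightarrow> (h has_integral (F t - F s)) {s..t}) \<and>
    (AE t in lborel. (F has_real_derivative h t) (at t))"
proof -
  have C0: "0 \<le> C" using order_trans[OF abs_ge_zero lip[of 0 1]] by simp
  define G where "G = (\<lambda>t. F t + C * t)"
  have "G s \<le> G t" "G t - G s \<le> (2 * C) * (t - s)" if "s \<le> t" for s t
    using lip[of s t] that unfolding G_def by (auto simp: abs_if algebra_simps split: if_splits)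
  then obtain g where g[measurable]: "g \<in> borel_measurable borel"
    and gint: "\<And>s t. s \<le> t \<Longrightarrow> (g has_integral (G t - G s)) {s..t}"
    using mono_lipschitz_indefinite_integral[of G "2 * C"] by blast
  define h0 where "h0 = (\<lambda>t. g t - C)"
  have h0int: "(h0 has_integral (F t - F s)) {s..t}" if "s \<le> t" for s t
  proof -
    have "(h0 has_integral ((G t - G s) - C * (t - s))) {s..t}"
      unfolding h0_def using has_integral_diff[OF gint[OF that] has_integral_const_real[of C s t]] that
      by (simp add: mult.commute)
    then show ?thesis by (simp add: G_def algebra_simps)
  qed
  have der0: "AE t in lborel. (F has_real_derivative h0 t) (at t)"
    using has_real_derivative_indefinite_integral_AE[OF h0int] by (simp add: AE_completion_iff)
  have h0le: "\<bar>h0 t\<bar> \<le> C" if "(F has_real_derivative h0 t) (at t)" for t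
  proof -
    have "((\<lambda>s. \<bar>(F s - F t) / (s - t)\<bar>) \<longlongrightarrow> \<bar>h0 t\<bar>) (at t)"
      using that unfolding has_field_derivative_iff by (rule tendsto_rabs)
    moreover have "\<bar>(F s - F t) / (s - t)\<bar> \<le> C" if "s \<noteq> t" for s
      using lip[of s t] that by (simp add: field_simps)
    then have "\<forall>\<^sub>F s in at t. \<bar>(F s - F t) / (s - t)\<bar> \<le> C"
      by (simp add: eventually_at_filter)
    ultimately show ?thesis
      by (rule tendsto_upperbound) simp
  qed
  \<comment> \<open>The bound by \<open>C\<close> is known for \<open>h0\<close> only where it is
    the derivative of \<open>F\<close>. Truncation enforces it at every point, as a pointwise
    supremum of such densities will require, and changes \<open>h0\<close> on a null set
    only.\<close>
  define h where "h = (\<lambda>t. max (- C) (min C (h0 t)))"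
  have eq: "h t = h0 t" if "\<bar>h0 t\<bar> \<le> C" for t
    using that by (auto simp: h_def)
  have ae: "AE t in lborel. h0 t = h t"
    using der0 by eventually_elim (simp add: eq h0le)
  show ?thesis
  proof (intro exI[of _ h] conjI allI impI)
    show "h \<in> borel_measurable borel" unfolding h_def h0_def by measurable
    show "\<bar>h t\<bar> \<le> C" for t using C0 by (auto simp: h_def)
    show "(h has_integral (F t - F s)) {s..t}" if "s \<le> t" for s t
    proof -
      have "AE x in lborel. x \<in> {s..t} \<longrightarrow> h0 x = h x" using ae by eventually_elim simp
      then show ?thesis using has_integral_AE[of "{s..t}" h0 h "F t - F s"] h0int[OF that] by blast
    qed
    show "AE t in lborel. (F has_real_derivative h t) (at t)"
      using der0 by eventually_elim (simp add: eq h0le)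
  qed
qed

text \<open>A single primitive on the whole line, based at 0, is the form in which
  \<open>has_real_derivative_indefinite_integral_AE\<close> can be applied.\<close>

lemma indefinite_integral_ex:
  fixes m :: "real \<Rightarrow> real"
  assumes "\<And>s t. m integrable_on {s..t}"
  obtains M where "\<And>s t. s \<le> t \<Longrightarrow> (m has_integral (M t - M s)) {s..t}"
proof
  let ?M = "\<lambda>t. if 0 \<le> t then integral {0..t} m else - integral {t..0} m"
  fix s t :: real assume "s \<le> t"
  have "integral {s..t} m = ?M t - ?M s"
    using Henstock_Kurzweil_Integration.integral_combine[of 0 s t m]
      Henstock_Kurzweil_Integration.integral_combine[of s 0 t m]
      Henstock_Kurzweil_Integration.integral_combine[of s t 0 m] assms \<open>s \<le> t\<close>
    by (cases "0 \<le> s"; cases "0 \<le> t") auto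
  then show "(m has_integral (?M t - ?M s)) {s..t}"
    using assms by (metis integrable_integral)
qed

subsection \<open>Metric derivatives and lengths of curves\<close>

text \<open>Here \<open>d s t\<close> is the distance between the positions of a curve at two times.
  By the reverse triangle inequality the quotient of \<open>d\<close> dominates that of every
  \<open>d s q\<close>, so its lower limit is at least each \<open>\<bar>h q t\<bar>\<close>. It is
  dominated by the quotient of \<open>M\<close>, a primitive of the supremum \<open>m\<close>, so
  its upper limit is at most \<open>m t\<close>. Both bounds hold where \<open>M\<close> and the
  countably many functions for rational \<open>q\<close> have their derivatives.\<close>

lemma metric_derivative_AE:
  fixes d :: "real \<Rightarrow> real \<Rightarrow> real"
  assumes nonneg: "\<And>s t. 0 \<le> d s t"
    and sym: "\<And>s t. d s t = d t s"
    and tri: "\<And>s t u. d s u \<le> d s t + d t u"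
    and lip: "\<And>s t. d s t \<le> C * \<bar>s - t\<bar>"
  shows "\<exists>m. m \<in> borel_measurable borel \<and> (\<forall>t. 0 \<le> m t) \<and>
    (\<forall>s t. s \<le> t \<longrightarrow> ennreal (d s t) \<le> (\<integral>\<^sup>+x\<in>{s..t}. ennreal (m x) \<partial>lborel)) \<and>
    (AE t in lborel. ((\<lambda>s. d s t / \<bar>s - t\<bar>) \<longlongrightarrow> m t) (at t))"
proof -
  have C0: "0 \<le> C" using lip[of 0 1] nonneg[of 0 1] by simp
  have dd: "\<bar>d s q - d t q\<bar> \<le> d s t" for s t q
    using tri[of s q t] tri[of t q s] sym[of s t] by auto
  then have "\<bar>d s q - d t q\<bar> \<le> C * \<bar>s - t\<bar>" for s t q
    using lip order_trans by blast
  note lipschitz_indefinite_integral[OF this]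
  then obtain h where hm[measurable]: "\<And>q. h q \<in> borel_measurable borel"
    and hC: "\<And>q t. \<bar>h q t\<bar> \<le> C"
    and hint: "\<And>q s t. s \<le> t \<Longrightarrow> (h q has_integral (d t q - d s q)) {s..t}"
    and hder: "\<And>q. AE t in lborel. ((\<lambda>s. d s q) has_real_derivative h q t) (at t)"
    by metis
  \<comment> \<open>Since \<open>d s t = sup\<^sub>q \<bar>d s q - d t q\<bar>\<close> over rational \<open>q\<close>, integrating the supremum of the densities bounds \<open>d s t\<close> from above.\<close>
  define m where "m = (\<lambda>t. SUP q\<in>\<rat>. \<bar>h q t\<bar>)"
  have Qne: "(\<rat> :: real set) \<noteq> {}" by auto
  have bdd: "bdd_above ((\<lambda>q. \<bar>h q t\<bar>) ` \<rat>)" for t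
    using hC by (intro bdd_aboveI[of _ C]) auto
  have hm_le: "\<bar>h q t\<bar> \<le> m t" if "q \<in> \<rat>" for q t
    unfolding m_def by (rule cSUP_upper[OF that bdd])
  have m0: "0 \<le> m t" for t
    using hm_le[of 0 t] by (simp add: order_trans[OF abs_ge_zero])
  have mC: "m t \<le> C" for t
    unfolding m_def by (rule cSUP_least[OF Qne hC])
  \<comment> \<open>Restricting \<open>q\<close> to the countable set of rationals keeps the
    supremum measurable.\<close>
  have mm[measurable]: "m \<in> borel_measurable borel"
    unfolding m_def by (intro borel_measurable_cSUP countable_rat bdd) measurable
  have mint: "m integrable_on {s..t}" for s t
  proof -
    have "set_integrable lborel {s..t} m"
      unfolding set_integrable_def
      by (rule integrableI_bounded_set[where A="{s..t}" and B=C])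
         (use mC m0 in \<open>auto simp: emeasure_lborel_Icc_eq indicator_def\<close>)
    then show ?thesis by (rule set_borel_integral_eq_integral)
  qed
  obtain M where M: "\<And>s t. s \<le> t \<Longrightarrow> (m has_integral (M t - M s)) {s..t}"
    using indefinite_integral_ex[OF mint] by blast
  have dM: "d s t \<le> M t - M s" if st: "s \<le> t" for s t
  proof (rule field_le_epsilon)
    fix e :: real assume "e > 0"
    \<comment> \<open>Since \<open>t\<close> may be irrational, a rational \<open>q\<close> just to
      the right of it stands in for it. The replacement costs \<open>d t q\<close> twice, at most
      \<open>2 * C * e'\<close>; the summand 1 in the denominator covers
      \<open>C = 0\<close>.\<close>
    define e' where "e' = e / (2 * C + 1)"
    have e': "e' > 0" "2 * C * e' \<le> e" using \<open>e > 0\<close> C0 by (auto simp: e'_def field_simps)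
    obtain q where q: "q \<in> \<rat>" "t < q" "q < t + e'"
      using Rats_dense_in_real[of t "t + e'"] e' by auto
    have "\<bar>d t q - d s q\<bar> \<le> M t - M s"
      using integral_norm_bound_integral[of "h q" "{s..t}" m] hint[OF st, of q] M[OF st] hm_le[OF q(1)]
      by (auto simp: integral_unique dest: has_integral_integrable)
    moreover have "d s t \<le> d s q + d t q" using tri[of s t q] sym[of q t] by simp
    moreover have "d t q \<le> C * e'"
      using lip[of t q] q C0 mult_left_mono[of "\<bar>t - q\<bar>" e' C] by auto
    ultimately show "d s t \<le> M t - M s + e" using e'(2) by (auto simp: abs_le_iff)
  qed
  have Mder: "AE t in lborel. (M has_real_derivative m t) (at t)"
    using has_real_derivative_indefinite_integral_AE[OF M] by (simp add: AE_completion_iff)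
  have "AE t in lborel. \<forall>q\<in>\<rat>. ((\<lambda>s. d s q) has_real_derivative h q t) (at t)"
    using hder by (simp add: AE_ball_countable[OF countable_rat])
  with Mder have lim: "AE t in lborel. ((\<lambda>s. d s t / \<bar>s - t\<bar>) \<longlongrightarrow> m t) (at t)"
  proof eventually_elim
    case (elim t)
    have ne: "\<forall>\<^sub>F s in at t. s \<noteq> t" by (simp add: eventually_at_filter)
    show ?case
    proof (rule order_tendstoI)
      fix a assume "a < m t"
      then obtain q where q: "q \<in> \<rat>" "a < \<bar>h q t\<bar>"
        unfolding m_def using less_cSUP_iff[OF Qne bdd, of a t] by auto
      have "((\<lambda>s. \<bar>(d s q - d t q) / (s - t)\<bar>) \<longlongrightarrow> \<bar>h q t\<bar>) (at t)"
        using elim(2) q(1) tendsto_rabs[of "\<lambda>s. (d s q - d t q) / (s - t)" "h q t" "at t"]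
        unfolding has_field_derivative_iff by blast
      then have "\<forall>\<^sub>F s in at t. a < \<bar>(d s q - d t q) / (s - t)\<bar>"
        using q(2) by (rule order_tendstoD)
      with ne show "\<forall>\<^sub>F s in at t. a < d s t / \<bar>s - t\<bar>"
      proof eventually_elim
        case (elim s)
        have "\<bar>(d s q - d t q) / (s - t)\<bar> \<le> d s t / \<bar>s - t\<bar>"
          unfolding abs_divide using dd by (intro divide_right_mono) auto
        then show ?case using elim by linarith
      qed
    next
      fix a assume "m t < a"
      have "((\<lambda>s. \<bar>(M s - M t) / (s - t)\<bar>) \<longlongrightarrow> \<bar>m t\<bar>) (at t)"
        using elim(1) tendsto_rabs[of "\<lambda>s. (M s - M t) / (s - t)" "m t" "at t"]
        unfolding has_field_derivative_iff by blast
      then have "\<forall>\<^sub>F s in at t. \<bar>(M s - M t) / (s - t)\<bar> < a"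
        using \<open>m t < a\<close> m0[of t] by (intro order_tendstoD) auto
      with ne show "\<forall>\<^sub>F s in at t. d s t / \<bar>s - t\<bar> < a"
      proof eventually_elim
        case (elim s)
        have "d s t \<le> \<bar>M s - M t\<bar>"
          using dM[of s t] dM[of t s] sym[of s t] by (cases "s \<le> t") auto
        then have "d s t / \<bar>s - t\<bar> \<le> \<bar>(M s - M t) / (s - t)\<bar>"
          unfolding abs_divide by (intro divide_right_mono) auto
        then show ?case using elim by linarith
      qed
    qed
  qed
  show ?thesis
  proof (intro exI[of _ m] conjI allI impI mm lim m0)
    fix s t :: real assume st: "s \<le> t"
    have "(\<integral>\<^sup>+x\<in>{s..t}. ennreal (m x) \<partial>lborel) = ennreal (M t - M s)"
      by (rule nn_integral_has_integral_lebesgue'[OF m0 M[OF st]])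
    then show "ennreal (d s t) \<le> (\<integral>\<^sup>+x\<in>{s..t}. ennreal (m x) \<partial>lborel)"
      using dM[OF st] by (simp add: ennreal_leI)
  qed
qed

text \<open>\<open>metric_speed\<close> is a \<open>Lim\<close>, unspecified where no limit exists.
  A Borel function \<open>m\<close> that agrees almost everywhere with the true limit gives an
  integrand to compute with. Only interior times are tested, where the limit is two-sided; the
  endpoints form a null set.\<close>

definition has_metric_speed ::
    "('a \<Rightarrow> 'a \<Rightarrow> real) \<Rightarrow> (real \<Rightarrow> 'a) \<Rightarrow> real \<Rightarrow> real \<Rightarrow> (real \<Rightarrow> real) \<Rightarrow> bool" where
  "has_metric_speed J f a b m \<longleftrightarrow> m \<in> borel_measurable borel \<and>
     (AE t in lborel. t \<in> {a<..<b} \<longrightarrow> ((\<lambda>s. J (f s) (f t) / \<bar>s - t\<bar>) \<longlongrightarrow> m t) (at t))"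

lemma path_len_eq_nn_integral:
  assumes "has_metric_speed J f a b m"
  shows "path_len J a b f = (\<integral>\<^sup>+t\<in>{a..b}. ennreal (m t) \<partial>lborel)"
  unfolding path_len_def nn_integral_completion
proof (rule nn_integral_cong_AE)
  have "AE t in lborel. t \<in> {a<..<b} \<longrightarrow> ((\<lambda>s. J (f s) (f t) / \<bar>s - t\<bar>) \<longlongrightarrow> m t) (at t)"
    using assms by (simp add: has_metric_speed_def)
  \<comment> \<open>With the endpoints discarded, the limit within [a, b] becomes the two-sided
    limit.\<close>
  moreover have "AE t in lborel. t \<noteq> a" "AE t in lborel. t \<noteq> b"
    by (rule AE_lborel_singleton)+
  ultimately show "AE t in lborel. ennreal (metric_speed J a b f t) * indicator {a..b} t =
      ennreal (m t) * indicator {a..b} t"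
  proof eventually_elim
    case (elim t)
    show ?case
    proof (cases "t \<in> {a..b}")
      case True
      with elim have t: "a < t" "t < b" by auto
      then have "((\<lambda>s. J (f s) (f t) / \<bar>s - t\<bar>) \<longlongrightarrow> m t) (at t)"
        using elim by simp
      then have "metric_speed J a b f t = m t"
        unfolding metric_speed_def at_within_Icc_at[OF t] by (intro tendsto_Lim) auto
      then show ?thesis by simp
    qed simp
  qed
qed

text \<open>The limit at an interior time sees only nearby times, so agreement on the open interval
  suffices. Glued curves can thus be compared with their halves without looking at the gluing
  point.\<close>

lemma has_metric_speed_cong:
  assumes m: "has_metric_speed J f a b m" and eq: "\<And>t. t \<in> {a<..<b} \<Longrightarrow> f t = g t"
  shows "has_metric_speed J g a b m"
proof -
  have "((\<lambda>s. J (g s) (g t) / \<bar>s - t\<bar>) \<longlongrightarrow> m t) (at t)"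
    if t: "t \<in> {a<..<b}" and lim: "((\<lambda>s. J (f s) (f t) / \<bar>s - t\<bar>) \<longlongrightarrow> m t) (at t)" for t
  proof (rule Lim_transform_eventually[OF lim])
    have "\<forall>\<^sub>F s in at t. s \<in> {a<..<b}"
      using t by (intro eventually_at_in_open') auto
    then show "\<forall>\<^sub>F s in at t. J (f s) (f t) / \<bar>s - t\<bar> = J (g s) (g t) / \<bar>s - t\<bar>"
      by eventually_elim (simp only: eq t)
  qed
  then show ?thesis
    using m unfolding has_metric_speed_def by (auto elim: eventually_mono)
qed

text \<open>Lebesgue measure is \<open>\<bar>c\<bar>\<close> times its image under the affine map,
  so both have the same null sets, and a statement about the image measure pulls back along the
  map.\<close>

lemma AE_lborel_affine:
  fixes c e :: real
  assumes "c \<noteq> 0" "AE x in lborel. P x"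
  shows "AE x in lborel. P (c * x + e)"
proof -
  have "AE x in density (distr lborel borel (\<lambda>x. e + c * x)) (\<lambda>_. ennreal \<bar>c\<bar>). P x"
    using assms(2) by (subst lborel_real_affine[OF assms(1), of e, symmetric])
  then have "AE x in distr lborel borel (\<lambda>x. e + c * x). P x"
    using assms(1) by (simp add: AE_density)
  then have "AE x in lborel. P (e + c * x)"
    by (rule AE_distrD[rotated]) simp
  then show ?thesis by (simp only: add.commute)
qed

lemma has_metric_speed_affine:
  assumes m: "has_metric_speed J f a b m" and c: "c \<noteq> 0"
    and sub: "\<And>t. t \<in> {a'<..<b'} \<Longrightarrow> c * t + e \<in> {a<..<b}"
  shows "has_metric_speed J (\<lambda>t. f (c * t + e)) a' b' (\<lambda>t. \<bar>c\<bar> * m (c * t + e))"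
  unfolding has_metric_speed_def
proof
  have [measurable]: "m \<in> borel_measurable borel"
    using m by (simp add: has_metric_speed_def)
  show "(\<lambda>t. \<bar>c\<bar> * m (c * t + e)) \<in> borel_measurable borel" by measurable
  have "AE t in lborel. c * t + e \<in> {a<..<b} \<longrightarrow>
      ((\<lambda>s. J (f s) (f (c * t + e)) / \<bar>s - (c * t + e)\<bar>) \<longlongrightarrow> m (c * t + e)) (at (c * t + e))"
    using m by (intro AE_lborel_affine c) (simp add: has_metric_speed_def)
  then show "AE t in lborel. t \<in> {a'<..<b'} \<longrightarrow>
      ((\<lambda>s. J (f (c * s + e)) (f (c * t + e)) / \<bar>s - t\<bar>) \<longlongrightarrow> \<bar>c\<bar> * m (c * t + e)) (at t)"
  proof eventually_elim
    case (elim t)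
    show ?case
    proof
      assume "t \<in> {a'<..<b'}"
      then have lim: "((\<lambda>s. J (f s) (f (c * t + e)) / \<bar>s - (c * t + e)\<bar>) \<longlongrightarrow> m (c * t + e)) (at (c * t + e))"
        using elim sub by blast
      \<comment> \<open>As \<open>c\<close> is nonzero, \<open>s\<close> different from
        \<open>t\<close> gives \<open>c * s + e\<close> different from \<open>c * t + e\<close>, so
        the punctured limits compose.\<close>
      have "filterlim (\<lambda>s. c * s + e) (at (c * t + e)) (at t)"
        unfolding filterlim_at using c
        by (auto intro!: tendsto_intros simp: eventually_at_filter)
      from tendsto_mult_left[OF filterlim_compose[OF lim this], of "\<bar>c\<bar>"]
      show "((\<lambda>s. J (f (c * s + e)) (f (c * t + e)) / \<bar>s - t\<bar>) \<longlongrightarrow> \<bar>c\<bar> * m (c * t + e)) (at t)"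
        using c by (simp add: right_diff_distrib[symmetric] abs_mult)
    qed
  qed
qed

text \<open>The factor \<open>\<bar>c\<bar>\<close> gained by the speed is exactly the Jacobian of
  the substitution. Negative \<open>c\<close> is allowed, which covers time reversal.\<close>

lemma path_len_affine:
  assumes m: "has_metric_speed J f a b m" and c: "c \<noteq> 0"
    and sub: "\<And>t. t \<in> {a'<..<b'} \<Longrightarrow> c * t + e \<in> {a<..<b}"
    and iff: "\<And>t. c * t + e \<in> {a..b} \<longleftrightarrow> t \<in> {a'..b'}"
  shows "path_len J a' b' (\<lambda>t. f (c * t + e)) = path_len J a b f"
proof -
  have [measurable]: "m \<in> borel_measurable borel"
    using m by (simp add: has_metric_speed_def)
  have "path_len J a b f = \<bar>c\<bar> * (\<integral>\<^sup>+t. ennreal (m (e + c * t)) * indicator {a..b} (e + c * t) \<partial>lborel)"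
    unfolding path_len_eq_nn_integral[OF m] using c by (intro nn_integral_real_affine) auto
  also have "\<dots> = (\<integral>\<^sup>+t. ennreal \<bar>c\<bar> * (ennreal (m (e + c * t)) * indicator {a..b} (e + c * t)) \<partial>lborel)"
    by (intro nn_integral_cmult[symmetric]) auto
  also have "\<dots> = (\<integral>\<^sup>+t\<in>{a'..b'}. ennreal (\<bar>c\<bar> * m (c * t + e)) \<partial>lborel)"
  proof (rule nn_integral_cong)
    fix t
    have "indicator {a..b} (e + c * t) = (indicator {a'..b'} t :: ennreal)"
      using iff[of t] by (simp add: indicator_def add.commute)
    then show "ennreal \<bar>c\<bar> * (ennreal (m (e + c * t)) * indicator {a..b} (e + c * t)) =
        ennreal (\<bar>c\<bar> * m (c * t + e)) * indicator {a'..b'} t"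
      by (simp add: ennreal_mult' add.commute mult.assoc)
  qed
  also have "\<dots> = path_len J a' b' (\<lambda>t. f (c * t + e))"
    by (rule path_len_eq_nn_integral[symmetric, OF has_metric_speed_affine[OF m c sub]])
  finally show ?thesis by simp
qed

lemma
  assumes m1: "has_metric_speed J f a c m1" and m2: "has_metric_speed J f c b m2"
    and ac: "a \<le> c" and cb: "c \<le> b"
  shows has_metric_speed_join: "has_metric_speed J f a b (\<lambda>t. if t \<le> c then m1 t else m2 t)"
    and path_len_join: "path_len J a b f = path_len J a c f + path_len J c b f"
proof -
  let ?m = "\<lambda>t. if t \<le> c then m1 t else m2 t"
  have [measurable]: "m1 \<in> borel_measurable borel" "m2 \<in> borel_measurable borel"
    using m1 m2 by (simp_all add: has_metric_speed_def)
  \<comment> \<open>The junction is discarded, since the speeds from the two sides may disagree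
    there.\<close>
  have ne: "AE t in lborel. t \<noteq> c" by (rule AE_lborel_singleton)
  have "AE t in lborel. t \<in> {a<..<c} \<longrightarrow> ((\<lambda>s. J (f s) (f t) / \<bar>s - t\<bar>) \<longlongrightarrow> m1 t) (at t)"
    "AE t in lborel. t \<in> {c<..<b} \<longrightarrow> ((\<lambda>s. J (f s) (f t) / \<bar>s - t\<bar>) \<longlongrightarrow> m2 t) (at t)"
    using m1 m2 by (simp_all add: has_metric_speed_def)
  with ne have "AE t in lborel. t \<in> {a<..<b} \<longrightarrow> ((\<lambda>s. J (f s) (f t) / \<bar>s - t\<bar>) \<longlongrightarrow> ?m t) (at t)"
    by eventually_elim auto
  then show m: "has_metric_speed J f a b ?m"
    by (simp add: has_metric_speed_def)
  have "path_len J a b f = (\<integral>\<^sup>+t. ennreal (m1 t) * indicator {a..c} t + ennreal (m2 t) * indicator {c..b} t \<partial>lborel)"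
    unfolding path_len_eq_nn_integral[OF m]
  proof (rule nn_integral_cong_AE)
    show "AE t in lborel. ennreal (?m t) * indicator {a..b} t =
        ennreal (m1 t) * indicator {a..c} t + ennreal (m2 t) * indicator {c..b} t"
      using ne by eventually_elim (use ac cb in \<open>auto split: split_indicator\<close>)
  qed
  also have "\<dots> = path_len J a c f + path_len J c b f"
    unfolding path_len_eq_nn_integral[OF m1] path_len_eq_nn_integral[OF m2]
    by (intro nn_integral_add) auto
  finally show "path_len J a b f = path_len J a c f + path_len J c b f" .
qed

section \<open>Metrics on a subset\<close>

lemma metric_onI:
  assumes pos: "\<And>x y. x \<in> S \<Longrightarrow> y \<in> S \<Longrightarrow> 0 \<le> d x y"
    and com: "\<And>x y. x \<in> S \<Longrightarrow> y \<in> S \<Longrightarrow> d x y = d y x"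
    and zero: "\<And>x y. x \<in> S \<Longrightarrow> y \<in> S \<Longrightarrow> d x y = 0 \<longleftrightarrow> x = y"
    and tri: "\<And>x y z. x \<in> S \<Longrightarrow> y \<in> S \<Longrightarrow> z \<in> S \<Longrightarrow> d x z \<le> d x y + d y z"
  shows "metric_on S d"
  unfolding metric_on_def
proof (rule Metric_space.intro)
  fix x y z
  show "0 \<le> (if x \<in> S \<and> y \<in> S then d x y else 0)"
    using pos[of x y] by simp
  show "(if x \<in> S \<and> y \<in> S then d x y else 0) = (if y \<in> S \<and> x \<in> S then d y x else 0)"
    using com[of x y] by (cases "x \<in> S"; cases "y \<in> S") simp_all
  show "(if x \<in> S \<and> y \<in> S then d x y else 0) = 0 \<longleftrightarrow> x = y" if "x \<in> S" "y \<in> S"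
    using zero[of x y] that by simp
  show "(if x \<in> S \<and> z \<in> S then d x z else 0) \<le>
      (if x \<in> S \<and> y \<in> S then d x y else 0) + (if y \<in> S \<and> z \<in> S then d y z else 0)"
    if "x \<in> S" "y \<in> S" "z \<in> S"
    using tri[of x y z] that by simp
qed

lemma metric_onD:
  assumes "metric_on S d" "x \<in> S" "y \<in> S"
  shows "0 \<le> d x y" "d x y = d y x" "d x y = 0 \<longleftrightarrow> x = y"
    and "z \<in> S \<Longrightarrow> d x z \<le> d x y + d y z"
proof -
  interpret Metric_space S "\<lambda>x y. if x \<in> S \<and> y \<in> S then d x y else 0"
    using assms(1) by (simp add: metric_on_def)
  show "0 \<le> d x y" "d x y = d y x" "d x y = 0 \<longleftrightarrow> x = y"
    using nonneg[of x y] commute[of x y] zero[of x y] assms by simp_all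
  show "z \<in> S \<Longrightarrow> d x z \<le> d x y + d y z"
    using triangle[of x y z] assms by simp
qed

lemma metric_on_subset:
  assumes "metric_on S d" "T \<subseteq> S"
  shows "metric_on T d"
  by (intro metric_onI metric_onD[OF assms(1)] subsetD[OF assms(2)])

section \<open>Speed and length of piecewise Lipschitz curves\<close>

lemma lipschitz_has_metric_speed:
  assumes uv: "u < v" and met: "metric_on (f ` {u..v}) J"
    and lip: "\<And>s t. s \<in> {u..v} \<Longrightarrow> t \<in> {u..v} \<Longrightarrow> J (f s) (f t) \<le> C * \<bar>s - t\<bar>"
  shows "\<exists>m. has_metric_speed J f u v m \<and> ennreal (J (f u) (f v)) \<le> path_len J u v f"
proof -
  \<comment> \<open>\<open>metric_derivative_AE\<close> concerns functions of two real times.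
    Clamping time to [u, v] is 1-Lipschitz, so it extends the distance along \<open>f\<close> to all
    times with the same constant \<open>C\<close>.\<close>
  define cl where "cl = (\<lambda>t. max u (min v t))"
  have cl: "cl t \<in> {u..v}" "\<bar>cl s - cl t\<bar> \<le> \<bar>s - t\<bar>" for s t
    using uv by (auto simp: cl_def)
  have cl_id: "cl t = t" if "t \<in> {u..v}" for t
    using that by (auto simp: cl_def)
  define d where "d = (\<lambda>s t. J (f (cl s)) (f (cl t)))"
  have "0 \<le> J (f u) (f v)" using uv by (intro metric_onD(1)[OF met]) auto
  also have "\<dots> \<le> C * \<bar>u - v\<bar>" using uv by (intro lip) auto
  finally have C0: "0 \<le> C" using uv by (simp add: zero_le_mult_iff)
  have fcl: "f (cl t) \<in> f ` {u..v}" for t using cl(1) by blast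
  have d: "0 \<le> d s t" "d s t = d t s" "d s r \<le> d s t + d t r" for s t r
    unfolding d_def by (intro metric_onD[OF met] fcl)+
  have dl: "d s t \<le> C * \<bar>s - t\<bar>" for s t
    using lip[OF cl(1) cl(1), of s t] mult_left_mono[OF cl(2) C0, of s t] by (simp add: d_def)
  obtain m where m: "m \<in> borel_measurable borel"
    "\<And>s t. s \<le> t \<Longrightarrow> ennreal (d s t) \<le> (\<integral>\<^sup>+x\<in>{s..t}. ennreal (m x) \<partial>lborel)"
    "AE t in lborel. ((\<lambda>s. d s t / \<bar>s - t\<bar>) \<longlongrightarrow> m t) (at t)"
    using metric_derivative_AE[OF d dl] by blast
  have "has_metric_speed J (\<lambda>t. f (cl t)) u v m"
    using m(1,3) unfolding has_metric_speed_def d_def by (auto elim: eventually_mono)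
  then have sp: "has_metric_speed J f u v m"
    by (rule has_metric_speed_cong) (simp add: cl_id)
  moreover have "ennreal (J (f u) (f v)) \<le> path_len J u v f"
    using m(2)[of u v] uv unfolding path_len_eq_nn_integral[OF sp] by (simp add: d_def cl_id)
  ultimately show ?thesis by blast
qed

text \<open>Each piece is at least as long as the distance of its endpoints, and lengths add. The
  order of \<open>p 0\<close> and \<open>p N\<close> and the existence of a speed are carried
  through the induction because joining the next piece requires both.\<close>

lemma piecewise_lipschitz_has_metric_speed:
  assumes "\<And>i. i < N \<Longrightarrow> p i < p (Suc i)"
    and "\<And>i. i < N \<Longrightarrow> metric_on (f ` {p i..p (Suc i)}) J"
    and "\<And>i. i < N \<Longrightarrow> \<exists>C. \<forall>s\<in>{p i..p (Suc i)}. \<forall>t\<in>{p i..p (Suc i)}. J (f s) (f t) \<le> C * \<bar>s - t\<bar>"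
  shows "p 0 \<le> p N \<and> (\<exists>m. has_metric_speed J f (p 0) (p N) m) \<and>
    (\<Sum>i<N. ennreal (J (f (p i)) (f (p (Suc i))))) \<le> path_len J (p 0) (p N) f"
  using assms
proof (induction N)
  case 0
  have "has_metric_speed J f (p 0) (p 0) (\<lambda>_. 0)" by (simp add: has_metric_speed_def)
  then show ?case by auto
next
  case (Suc N)
  then obtain m1 where IH: "p 0 \<le> p N" "has_metric_speed J f (p 0) (p N) m1"
    "(\<Sum>i<N. ennreal (J (f (p i)) (f (p (Suc i))))) \<le> path_len J (p 0) (p N) f"
    by auto
  have lt: "p N < p (Suc N)" using Suc.prems by simp
  obtain C where C: "\<And>s t. s \<in> {p N..p (Suc N)} \<Longrightarrow> t \<in> {p N..p (Suc N)} \<Longrightarrow> J (f s) (f t) \<le> C * \<bar>s - t\<bar>"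
    using Suc.prems(3)[of N] by blast
  obtain m2 where m2: "has_metric_speed J f (p N) (p (Suc N)) m2"
    "ennreal (J (f (p N)) (f (p (Suc N)))) \<le> path_len J (p N) (p (Suc N)) f"
    using lipschitz_has_metric_speed[OF lt Suc.prems(2)[OF lessI], of C] C by blast
  have "(\<Sum>i<Suc N. ennreal (J (f (p i)) (f (p (Suc i))))) \<le> path_len J (p 0) (p (Suc N)) f"
    unfolding path_len_join[OF IH(2) m2(1) IH(1) less_imp_le[OF lt]] sum.lessThan_Suc
    by (intro add_mono IH(3) m2(2))
  moreover have "p 0 \<le> p (Suc N)" using IH(1) lt by simp
  ultimately show ?case
    using has_metric_speed_join[OF IH(2) m2(1) IH(1) less_imp_le[OF lt]] by blast
qed

subsection \<open>Piecewise Lipschitz paths\<close>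

lemma quasimetric_onD:
  assumes "quasimetric_on X J" "x \<in> X" "y \<in> X"
  shows "0 \<le> J x y" "J x y = 0 \<longleftrightarrow> x = y" "J x y = J y x"
  using assms unfolding quasimetric_on_def by simp_all

definition lipschitz_piece :: "('a \<Rightarrow> 'a \<Rightarrow> real) \<Rightarrow> (real \<Rightarrow> 'a) \<Rightarrow> real \<Rightarrow> real \<Rightarrow> bool" where
  "lipschitz_piece J f u v \<longleftrightarrow> u < v \<and> metric_on (f ` {u..v}) J \<and>
     (\<exists>C. \<forall>s\<in>{u..v}. \<forall>t\<in>{u..v}. J (f s) (f t) \<le> C * \<bar>s - t\<bar>)"

lemma pw_lipschitz_maps_iff:
  "f \<in> pw_lipschitz_maps X J a b N \<longleftrightarrow> f ` {a..b} \<subseteq> X \<and> quasi_continuous J a b f \<and>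
     (\<exists>p. p 0 = a \<and> p N = b \<and> (\<forall>i<N. lipschitz_piece J f (p i) (p (Suc i))))"
  unfolding pw_lipschitz_maps_def lipschitz_piece_def by auto

lemma lipschitz_piece_partition_mono:
  assumes "\<And>i. i < N \<Longrightarrow> lipschitz_piece J f (p i) (p (Suc i))"
  shows "i \<le> j \<Longrightarrow> j \<le> N \<Longrightarrow> p i \<le> p j"
proof (induction j)
  case (Suc j)
  then show ?case using assms[of j] by (cases "i = Suc j") (auto simp: lipschitz_piece_def)
qed simp

text \<open>The new image lies in the old one, and the Lipschitz constant is multiplied by
  \<open>\<bar>c\<bar>\<close>. With \<open>c = 1\<close> and \<open>e = 0\<close> this is
  restriction to a subinterval; with \<open>c = - 1\<close> it serves reversal.\<close>

lemma lipschitz_piece_affine: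
  assumes "lipschitz_piece J f u v" "u' < v'"
    and sub: "\<And>t. t \<in> {u'..v'} \<Longrightarrow> c * t + e \<in> {u..v}"
  shows "lipschitz_piece J (\<lambda>t. f (c * t + e)) u' v'"
proof -
  obtain C where met: "metric_on (f ` {u..v}) J"
    and C: "\<And>s t. s \<in> {u..v} \<Longrightarrow> t \<in> {u..v} \<Longrightarrow> J (f s) (f t) \<le> C * \<bar>s - t\<bar>"
    using assms(1) unfolding lipschitz_piece_def by blast
  have "J (f (c * s + e)) (f (c * t + e)) \<le> (C * \<bar>c\<bar>) * \<bar>s - t\<bar>"
    if "s \<in> {u'..v'}" "t \<in> {u'..v'}" for s t
    using C[OF sub[OF that(1)] sub[OF that(2)]]
    by (simp add: right_diff_distrib[symmetric] abs_mult mult.assoc)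
  moreover have "metric_on ((\<lambda>t. f (c * t + e)) ` {u'..v'}) J"
    by (rule metric_on_subset[OF met]) (use sub in blast)
  ultimately show ?thesis
    using assms(2) unfolding lipschitz_piece_def by blast
qed

lemma lipschitz_piece_cong:
  assumes "lipschitz_piece J f u v" "\<And>t. t \<in> {u..v} \<Longrightarrow> f t = g t"
  shows "lipschitz_piece J g u v"
proof -
  have "f ` {u..v} = g ` {u..v}" using assms(2) by (rule image_cong[OF refl])
  then show ?thesis using assms unfolding lipschitz_piece_def by auto
qed

lemma quasi_continuousD:
  assumes "quasi_continuous J a b f" "t \<in> {a..b}" "\<And>n. u n \<in> {a..b}" "u \<longlonglongrightarrow> t"
  shows "(\<lambda>n. J (f (u n)) (f t)) \<longlonglongrightarrow> 0"
  using assms unfolding quasi_continuous_def by blast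

lemma quasi_continuous_affine:
  assumes "quasi_continuous J a b f"
    and sub: "\<And>t. t \<in> {a'..b'} \<Longrightarrow> c * t + e \<in> {a..b}"
  shows "quasi_continuous J a' b' (\<lambda>t. f (c * t + e))"
  unfolding quasi_continuous_def
proof (intro ballI allI impI)
  fix t u assume t: "t \<in> {a'..b'}" and u: "(\<forall>n. u n \<in> {a'..b'}) \<and> u \<longlonglongrightarrow> t"
  show "(\<lambda>n. J (f (c * u n + e)) (f (c * t + e))) \<longlonglongrightarrow> 0"
  proof (rule quasi_continuousD[OF assms(1) sub[OF t], where u = "\<lambda>n. c * u n + e"])
    show "c * u n + e \<in> {a..b}" for n using u by (intro sub) blast
    show "(\<lambda>n. c * u n + e) \<longlonglongrightarrow> c * t + e" using u by (intro tendsto_intros) blast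
  qed
qed

lemma quasi_continuous_cong:
  assumes "quasi_continuous J a b f" "\<And>t. t \<in> {a..b} \<Longrightarrow> f t = g t"
  shows "quasi_continuous J a b g"
  using assms unfolding quasi_continuous_def by simp

lemma quasi_continuous_join:
  assumes 1: "quasi_continuous J a c f" and 2: "quasi_continuous J c b f"
    and ac: "a \<le> c" and cb: "c \<le> b" and zero: "J (f c) (f c) = 0"
  shows "quasi_continuous J a b f"
  unfolding quasi_continuous_def
proof (intro ballI allI impI)
  fix t u assume t: "t \<in> {a..b}" and u: "(\<forall>n. u n \<in> {a..b}) \<and> u \<longlonglongrightarrow> t"
  have ub: "u n \<in> {a..b}" for n using u by blast
  \<comment> \<open>A sequence tending to \<open>c\<close> may change sides infinitely often. Taking
    \<open>min\<close> and \<open>max\<close> with \<open>c\<close> splits it into two one-sided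
    sequences; in the case \<open>t = c\<close>, for each \<open>n\<close> one of the two terms is
    \<open>J (f c) (f c) = 0\<close>, so their sum is the original term.\<close>
  have u1: "min (u n) c \<in> {a..c}" and u2: "max (u n) c \<in> {c..b}" for n
    using ub[of n] ac cb by auto
  have m1: "(\<lambda>n. min (u n) c) \<longlonglongrightarrow> min t c" and m2: "(\<lambda>n. max (u n) c) \<longlonglongrightarrow> max t c"
    using u by (intro tendsto_intros; blast)+
  consider "t < c" | "t = c" | "t > c" by linarith
  then show "(\<lambda>n. J (f (u n)) (f t)) \<longlonglongrightarrow> 0"
  proof cases
    case 1
    then have "(\<lambda>n. J (f (min (u n) c)) (f t)) \<longlonglongrightarrow> 0"
      using t u1 m1 by (intro quasi_continuousD[OF assms(1)]) auto
    moreover have "\<forall>\<^sub>F n in sequentially. u n < c"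
      using u 1 by (intro order_tendstoD(2)) auto
    then have "\<forall>\<^sub>F n in sequentially. J (f (min (u n) c)) (f t) = J (f (u n)) (f t)"
      by eventually_elim simp
    ultimately show ?thesis by (rule Lim_transform_eventually)
  next
    case 2
    have "(\<lambda>n. J (f (min (u n) c)) (f c)) \<longlonglongrightarrow> 0"
      using u1 m1 ac 2 by (intro quasi_continuousD[OF assms(1)]) auto
    moreover have "(\<lambda>n. J (f (max (u n) c)) (f c)) \<longlonglongrightarrow> 0"
      using u2 m2 cb 2 by (intro quasi_continuousD[OF assms(2)]) auto
    ultimately have "(\<lambda>n. J (f (min (u n) c)) (f c) + J (f (max (u n) c)) (f c)) \<longlonglongrightarrow> 0"
      by (rule tendsto_add_zero)
    moreover have "J (f (min (u n) c)) (f c) + J (f (max (u n) c)) (f c) = J (f (u n)) (f t)" for n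
      using zero 2 by (cases "u n \<le> c") (auto simp: min_def max_def)
    ultimately show ?thesis by simp
  next
    case 3
    then have "(\<lambda>n. J (f (max (u n) c)) (f t)) \<longlonglongrightarrow> 0"
      using t u2 m2 by (intro quasi_continuousD[OF assms(2)]) auto
    moreover have "\<forall>\<^sub>F n in sequentially. c < u n"
      using u 3 by (intro order_tendstoD(1)) auto
    then have "\<forall>\<^sub>F n in sequentially. J (f (max (u n) c)) (f t) = J (f (u n)) (f t)"
      by eventually_elim simp
    ultimately show ?thesis by (rule Lim_transform_eventually)
  qed
qed

lemma pw_lipschitz_maps_cong:
  assumes "f \<in> pw_lipschitz_maps X J a b N" and eq: "\<And>t. t \<in> {a..b} \<Longrightarrow> f t = g t"
  shows "g \<in> pw_lipschitz_maps X J a b N"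
proof -
  obtain p where f: "f ` {a..b} \<subseteq> X" "quasi_continuous J a b f"
    and p: "p 0 = a" "p N = b" and pc: "\<And>i. i < N \<Longrightarrow> lipschitz_piece J f (p i) (p (Suc i))"
    using assms(1) unfolding pw_lipschitz_maps_iff by blast
  note inc = lipschitz_piece_partition_mono[of N J f p, OF pc]
  have "lipschitz_piece J g (p i) (p (Suc i))" if "i < N" for i
  proof (rule lipschitz_piece_cong[OF pc[OF that]])
    fix t assume "t \<in> {p i..p (Suc i)}"
    then show "f t = g t" using inc[of 0 i] inc[of "Suc i" N] that p by (intro eq) auto
  qed
  moreover have "g ` {a..b} \<subseteq> X" using f(1) eq by auto
  ultimately show ?thesis
    using quasi_continuous_cong[OF f(2) eq] p unfolding pw_lipschitz_maps_iff by blast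
qed

lemma pw_lipschitz_maps_affine:
  assumes "f \<in> pw_lipschitz_maps X J (c * a + e) (c * b + e) N" and c: "0 < c"
  shows "(\<lambda>t. f (c * t + e)) \<in> pw_lipschitz_maps X J a b N"
proof -
  obtain p where f: "f ` {c * a + e..c * b + e} \<subseteq> X" "quasi_continuous J (c * a + e) (c * b + e) f"
    and p: "p 0 = c * a + e" "p N = c * b + e"
    and pc: "\<And>i. i < N \<Longrightarrow> lipschitz_piece J f (p i) (p (Suc i))"
    using assms(1) unfolding pw_lipschitz_maps_iff by blast
  have sub: "c * t + e \<in> {c * a + e..c * b + e}" if "t \<in> {a..b}" for t
    using that c by auto
  define q where "q = (\<lambda>i. (p i - e) / c)"
  have q: "c * q i + e = p i" for i using c by (simp add: q_def)
  have "lipschitz_piece J (\<lambda>t. f (c * t + e)) (q i) (q (Suc i))" if "i < N" for i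
  proof (rule lipschitz_piece_affine[OF pc[OF that]])
    show "q i < q (Suc i)"
      using pc[OF that] c by (simp add: q_def lipschitz_piece_def divide_strict_right_mono)
    fix t assume "t \<in> {q i..q (Suc i)}"
    then have "c * q i \<le> c * t" "c * t \<le> c * q (Suc i)" using c by simp_all
    then show "c * t + e \<in> {p i..p (Suc i)}" unfolding q[symmetric] by simp
  qed
  moreover have "q 0 = a" "q N = b" using p c by (simp_all add: q_def)
  moreover have "(\<lambda>t. f (c * t + e)) ` {a..b} \<subseteq> X" using f(1) sub by blast
  ultimately show ?thesis
    using quasi_continuous_affine[OF f(2) sub] unfolding pw_lipschitz_maps_iff by blast
qed

lemma pw_lipschitz_maps_reverse:
  assumes "f \<in> pw_lipschitz_maps X J (e - b) (e - a) N"
  shows "(\<lambda>t. f (e - t)) \<in> pw_lipschitz_maps X J a b N"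
proof -
  obtain p where f: "f ` {e - b..e - a} \<subseteq> X" "quasi_continuous J (e - b) (e - a) f"
    and p: "p 0 = e - b" "p N = e - a"
    and pc: "\<And>i. i < N \<Longrightarrow> lipschitz_piece J f (p i) (p (Suc i))"
    using assms(1) unfolding pw_lipschitz_maps_iff by blast
  have sub: "- 1 * t + e \<in> {e - b..e - a}" if "t \<in> {a..b}" for t
    using that by auto
  define q where "q = (\<lambda>i. e - p (N - i))"
  have "lipschitz_piece J (\<lambda>t. f (- 1 * t + e)) (q i) (q (Suc i))" if "i < N" for i
  proof -
    \<comment> \<open>Piece \<open>i\<close> of the reversed partition comes from piece
      \<open>N - Suc i\<close> of the original one.\<close>
    have S: "Suc (N - Suc i) = N - i" using that by simp
    then have pc': "lipschitz_piece J f (p (N - Suc i)) (p (N - i))"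
      using pc[of "N - Suc i"] that by simp
    show ?thesis
    proof (rule lipschitz_piece_affine[OF pc'])
      show "q i < q (Suc i)"
        using pc' by (simp add: q_def lipschitz_piece_def)
      show "- 1 * t + e \<in> {p (N - Suc i)..p (N - i)}" if "t \<in> {q i..q (Suc i)}" for t
        using that by (simp add: q_def)
    qed
  qed
  moreover have "q 0 = a" "q N = b" using p by (simp_all add: q_def)
  moreover have "(\<lambda>t. f (- 1 * t + e)) ` {a..b} \<subseteq> X" using f(1) sub by blast
  ultimately have "(\<lambda>t. f (- 1 * t + e)) \<in> pw_lipschitz_maps X J a b N"
    using quasi_continuous_affine[OF f(2) sub] unfolding pw_lipschitz_maps_iff by blast
  then show ?thesis by simp
qed

lemma pw_lipschitz_maps_join:
  assumes q: "quasimetric_on X J"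
    and 1: "f \<in> pw_lipschitz_maps X J a c N" and 2: "f \<in> pw_lipschitz_maps X J c b M"
    and ac: "a \<le> c" and cb: "c \<le> b"
  shows "f \<in> pw_lipschitz_maps X J a b (N + M)"
proof -
  obtain p where f: "f ` {a..c} \<subseteq> X" "quasi_continuous J a c f"
    and p: "p 0 = a" "p N = c" and pc: "\<And>i. i < N \<Longrightarrow> lipschitz_piece J f (p i) (p (Suc i))"
    using 1 unfolding pw_lipschitz_maps_iff by blast
  obtain r where g: "f ` {c..b} \<subseteq> X" "quasi_continuous J c b f"
    and r: "r 0 = c" "r M = b" and rc: "\<And>i. i < M \<Longrightarrow> lipschitz_piece J f (r i) (r (Suc i))"
    using 2 unfolding pw_lipschitz_maps_iff by blast
  define w where "w = (\<lambda>i. if i \<le> N then p i else r (i - N))"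
  have "lipschitz_piece J f (w i) (w (Suc i))" if "i < N + M" for i
  proof (cases "i < N")
    case True
    then show ?thesis using pc by (simp add: w_def)
  next
    case False
    \<comment> \<open>At \<open>i = N\<close> the definition of \<open>w\<close> selects
      \<open>p N\<close>, which equals \<open>r 0\<close> because both are \<open>c\<close>.\<close>
    then have "w i = r (i - N)" "w (Suc i) = r (Suc (i - N))"
      using p r by (auto simp: w_def Suc_diff_le)
    then show ?thesis using rc[of "i - N"] False that by simp
  qed
  moreover have "w 0 = a" "w (N + M) = b" using p r by (auto simp: w_def)
  moreover have "f ` {a..b} \<subseteq> X"
    using f(1) g(1) ivl_disj_un_two_touch(4)[OF ac cb] by (metis image_Un Un_subset_iff)
  moreover have "quasi_continuous J a b f"
  proof (rule quasi_continuous_join[OF f(2) g(2) ac cb])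
    have "f c \<in> X" using f(1) ac by auto
    then show "J (f c) (f c) = 0" by (simp add: quasimetric_onD(2)[OF q])
  qed
  ultimately show ?thesis unfolding pw_lipschitz_maps_iff by blast
qed

text \<open>Halving the last piece adds a partition point. This makes \<open>path_dist_N\<close>
  nonincreasing in \<open>N\<close>, so that \<open>path_dist\<close> is an infimum.\<close>

lemma pw_lipschitz_maps_Suc:
  assumes "f \<in> pw_lipschitz_maps X J a b N" "a < b"
  shows "f \<in> pw_lipschitz_maps X J a b (Suc N)"
proof -
  obtain p where f: "f ` {a..b} \<subseteq> X" "quasi_continuous J a b f"
    and p: "p 0 = a" "p N = b" and pc: "\<And>i. i < N \<Longrightarrow> lipschitz_piece J f (p i) (p (Suc i))"
    using assms(1) unfolding pw_lipschitz_maps_iff by blast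
  \<comment> \<open>A partition without pieces would force \<open>a = b\<close>, so a last piece
    exists.\<close>
  obtain n where n: "N = Suc n" using p assms(2) by (cases N) auto
  define w where "w = p(Suc n := (p n + p (Suc n)) / 2, Suc (Suc n) := p (Suc n))"
  have refine: "lipschitz_piece J f u v"
    if "lipschitz_piece J f s t" "s \<le> u" "u < v" "v \<le> t" for u v s t
    using lipschitz_piece_affine[OF that(1,3), of 1 0] that by auto
  have last: "lipschitz_piece J f (p n) (p (Suc n))" "p n < p (Suc n)"
    using pc[of n] n by (auto simp: lipschitz_piece_def)
  have "lipschitz_piece J f (w i) (w (Suc i))" if i: "i < Suc N" for i
  proof -
    consider "i < n" | "i = n" | "i = Suc n" using i n by linarith
    then show ?thesis
    proof cases
      case 1
      then show ?thesis using pc n by (simp add: w_def)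
    next
      case 2
      then show ?thesis using last by (simp add: w_def) (rule refine[OF last(1)], auto)
    next
      case 3
      then show ?thesis using last by (simp add: w_def) (rule refine[OF last(1)], auto)
    qed
  qed
  moreover have "w 0 = a" "w (Suc N) = b" using p n by (auto simp: w_def)
  ultimately show ?thesis using f unfolding pw_lipschitz_maps_iff by blast
qed

text \<open>The values of \<open>f\<close> at the partition points form the chain \<open>c\<close>.
  It is the link between path lengths and \<open>chain_dist\<close>.\<close>

lemma pw_lipschitz_maps_has_metric_speed:
  assumes "f \<in> pw_lipschitz_maps X J a b N"
  shows "\<exists>m. has_metric_speed J f a b m"
    and "\<exists>c. (\<forall>i\<le>N. c i \<in> X) \<and> c 0 = f a \<and> c N = f b \<and>
      (\<Sum>i<N. ennreal (J (c i) (c (Suc i)))) \<le> path_len J a b f"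
proof -
  obtain p where f: "f ` {a..b} \<subseteq> X"
    and p: "p 0 = a" "p N = b" and pc: "\<And>i. i < N \<Longrightarrow> lipschitz_piece J f (p i) (p (Suc i))"
    using assms(1) unfolding pw_lipschitz_maps_iff by blast
  note inc = lipschitz_piece_partition_mono[of N J f p, OF pc]
  have *: "(\<exists>m. has_metric_speed J f a b m) \<and>
    (\<Sum>i<N. ennreal (J (f (p i)) (f (p (Suc i))))) \<le> path_len J a b f"
    using piecewise_lipschitz_has_metric_speed[of N p f J] pc p unfolding lipschitz_piece_def by simp
  then show "\<exists>m. has_metric_speed J f a b m" by blast
  have "p i \<in> {a..b}" if "i \<le> N" for i
    using inc[of 0 i] inc[of i N] that p by simp
  then have "\<forall>i\<le>N. f (p i) \<in> X" using f by blast
  then show "\<exists>c. (\<forall>i\<le>N. c i \<in> X) \<and> c 0 = f a \<and> c N = f b \<and>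
      (\<Sum>i<N. ennreal (J (c i) (c (Suc i)))) \<le> path_len J a b f"
    using * p by (intro exI[of _ "\<lambda>i. f (p i)"]) simp
qed

section \<open>Constant, reversed and concatenated paths\<close>

lemma const_paths_between:
  assumes "quasimetric_on X J" "x \<in> X"
  shows "(\<lambda>_. x) \<in> paths_between X J 1 x x" "path_len J 0 1 (\<lambda>_. x) = 0"
proof -
  have J: "J x x = 0" using quasimetric_onD(2)[OF assms(1,2,2)] by simp
  then have "metric_on {x} J" by (intro metric_onI) auto
  then have "lipschitz_piece J (\<lambda>_. x) 0 1"
    unfolding lipschitz_piece_def by (auto simp: J image_constant_conv intro!: exI[of _ 0])
  moreover have "quasi_continuous J 0 1 (\<lambda>_. x)" by (simp add: quasi_continuous_def J)
  \<comment> \<open>The witness \<open>real\<close>, as a map on the naturals, is the partition with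
    the two points 0 and 1.\<close>
  ultimately show "(\<lambda>_. x) \<in> paths_between X J 1 x x"
    using assms(2) unfolding paths_between_def pw_lipschitz_maps_iff
    by (auto intro!: exI[of _ real])
  have "has_metric_speed J (\<lambda>_. x) 0 1 (\<lambda>_. 0)"
    by (simp add: has_metric_speed_def J)
  then show "path_len J 0 1 (\<lambda>_. x) = 0"
    by (simp add: path_len_eq_nn_integral)
qed

lemma reverse_paths_between:
  assumes "f \<in> paths_between X J N x y"
  shows "(\<lambda>t. f (1 - t)) \<in> paths_between X J N y x"
    and "path_len J 0 1 (\<lambda>t. f (1 - t)) = path_len J 0 1 f"
proof -
  have f: "f \<in> pw_lipschitz_maps X J 0 1 N" "f 0 = x" "f 1 = y"
    using assms by (auto simp: paths_between_def)
  then show "(\<lambda>t. f (1 - t)) \<in> paths_between X J N y x"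
    using pw_lipschitz_maps_reverse[of f X J 1 1 0 N] by (simp add: paths_between_def)
  obtain m where "has_metric_speed J f 0 1 m"
    using pw_lipschitz_maps_has_metric_speed(1)[OF f(1)] by blast
  \<comment> \<open>Reversal is the affine change of parameter with slope -1 and offset 1.\<close>
  from path_len_affine[OF this, of "- 1" 0 1 1]
  show "path_len J 0 1 (\<lambda>t. f (1 - t)) = path_len J 0 1 f" by auto
qed

lemma concat_paths_between:
  assumes q: "quasimetric_on X J"
    and f: "f \<in> paths_between X J N x y" and g: "g \<in> paths_between X J M y z"
  shows "\<exists>h. h \<in> paths_between X J (N + M) x z \<and> path_len J 0 1 h = path_len J 0 1 f + path_len J 0 1 g"
proof (intro exI conjI)
  have f': "f \<in> pw_lipschitz_maps X J 0 1 N" "f 0 = x" "f 1 = y"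
    and g': "g \<in> pw_lipschitz_maps X J 0 1 M" "g 0 = y" "g 1 = z"
    using f g by (auto simp: paths_between_def)
  \<comment> \<open>Each half runs at double speed. The summands \<open>+ 0\<close> and
    \<open>+ (- 1)\<close> keep both arguments in the shape \<open>c * t + e\<close> of the affine
    lemmas.\<close>
  let ?h = "\<lambda>t. if t \<le> 1 / 2 then f (2 * t + 0) else g (2 * t + (- 1))"
  have h1: "f (2 * t + 0) = ?h t" if "t \<in> {0..1 / 2}" for t :: real
    using that by simp
  have h2: "g (2 * t + (- 1)) = ?h t" if "t \<in> {1 / 2..1}" for t :: real
  proof (cases "t = 1 / 2")
    case True
    show ?thesis unfolding True using f' g' by simp
  qed (use that in auto)
  have "(\<lambda>t. f (2 * t + 0)) \<in> pw_lipschitz_maps X J 0 (1 / 2) N"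
    using f' by (intro pw_lipschitz_maps_affine) auto
  then have P1: "?h \<in> pw_lipschitz_maps X J 0 (1 / 2) N"
    by (rule pw_lipschitz_maps_cong) (rule h1)
  have "(\<lambda>t. g (2 * t + (- 1))) \<in> pw_lipschitz_maps X J (1 / 2) 1 M"
    using g' by (intro pw_lipschitz_maps_affine) auto
  then have P2: "?h \<in> pw_lipschitz_maps X J (1 / 2) 1 M"
    by (rule pw_lipschitz_maps_cong) (rule h2)
  have "?h \<in> pw_lipschitz_maps X J 0 1 (N + M)"
    by (rule pw_lipschitz_maps_join[OF q P1 P2]) auto
  then show "?h \<in> paths_between X J (N + M) x z"
    using f' g' by (simp add: paths_between_def)
  obtain m1 where m1: "has_metric_speed J f 0 1 m1"
    using pw_lipschitz_maps_has_metric_speed(1)[OF f'(1)] by blast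
  obtain m2 where m2: "has_metric_speed J g 0 1 m2"
    using pw_lipschitz_maps_has_metric_speed(1)[OF g'(1)] by blast
  have s1: "has_metric_speed J (\<lambda>t. f (2 * t + 0)) 0 (1 / 2) (\<lambda>t. \<bar>2\<bar> * m1 (2 * t + 0))"
    by (rule has_metric_speed_affine[OF m1]) auto
  have s2: "has_metric_speed J (\<lambda>t. g (2 * t + (- 1))) (1 / 2) 1 (\<lambda>t. \<bar>2\<bar> * m2 (2 * t + (- 1)))"
    by (rule has_metric_speed_affine[OF m2]) auto
  have s1': "has_metric_speed J ?h 0 (1 / 2) (\<lambda>t. \<bar>2\<bar> * m1 (2 * t + 0))"
    by (rule has_metric_speed_cong[OF s1]) auto
  have s2': "has_metric_speed J ?h (1 / 2) 1 (\<lambda>t. \<bar>2\<bar> * m2 (2 * t + (- 1)))"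
    by (rule has_metric_speed_cong[OF s2]) auto
  have "path_len J 0 1 ?h = path_len J 0 (1 / 2) ?h + path_len J (1 / 2) 1 ?h"
    by (rule path_len_join[OF s1' s2']) auto
  also have "path_len J 0 (1 / 2) ?h = path_len J 0 (1 / 2) (\<lambda>t. f (2 * t + 0))"
    by (simp only: path_len_eq_nn_integral[OF s1] path_len_eq_nn_integral[OF s1'])
  also have "\<dots> = path_len J 0 1 f"
    by (rule path_len_affine[OF m1]) auto
  also have "path_len J (1 / 2) 1 ?h = path_len J (1 / 2) 1 (\<lambda>t. g (2 * t + (- 1)))"
    by (simp only: path_len_eq_nn_integral[OF s2] path_len_eq_nn_integral[OF s2'])
  also have "\<dots> = path_len J 0 1 g"
    by (rule path_len_affine[OF m2]) auto
  finally show "path_len J 0 1 ?h = path_len J 0 1 f + path_len J 0 1 g" .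
qed

section \<open>The path distance: infimum form, symmetry, triangle inequality\<close>

lemma path_dist_eq_INF: "path_dist X J x y = (INF N. path_dist_N X J N x y)"
  unfolding path_dist_def
proof (rule limI, rule LIMSEQ_INF)
  \<comment> \<open>A path with \<open>N\<close> pieces is also one with \<open>Suc N\<close>
    pieces, so the infimum is taken over growing sets and its limit in \<open>ennreal\<close> is the
    infimum over \<open>N\<close>.\<close>
  show "decseq (\<lambda>N. path_dist_N X J N x y)"
    unfolding decseq_Suc_iff path_dist_N_def
    by (auto intro!: INF_superset_mono simp: paths_between_def pw_lipschitz_maps_Suc)
qed

lemma path_dist_le:
  assumes "f \<in> paths_between X J N x y"
  shows "path_dist X J x y \<le> path_len J 0 1 f"
  unfolding path_dist_eq_INF path_dist_N_def using assms
  by (intro INF_lower2[of N] INF_lower2[of f]) auto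

lemma path_dist_less:
  assumes "path_dist X J x y < r"
  obtains N f where "f \<in> paths_between X J N x y" "path_len J 0 1 f < r"
  using assms unfolding path_dist_eq_INF path_dist_N_def INF_less_iff by blast

lemma path_dist_self:
  assumes "quasimetric_on X J" "x \<in> X"
  shows "path_dist X J x x = 0"
  using path_dist_le[OF const_paths_between(1)[OF assms]] const_paths_between(2)[OF assms] by simp

lemma path_dist_sym_le: "path_dist X J y x \<le> path_dist X J x y"
proof (rule ccontr)
  assume "\<not> path_dist X J y x \<le> path_dist X J x y"
  then have "path_dist X J x y < path_dist X J y x" by simp
  then obtain N f where f: "f \<in> paths_between X J N x y" "path_len J 0 1 f < path_dist X J y x"
    by (rule path_dist_less)
  then show False
    using path_dist_le[OF reverse_paths_between(1)[OF f(1)]] reverse_paths_between(2)[OF f(1)] by simp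
qed

lemma path_dist_triangle:
  assumes "quasimetric_on X J"
  shows "path_dist X J x z \<le> path_dist X J x y + path_dist X J y z"
proof (rule ennreal_le_epsilon)
  fix e :: real assume fin: "path_dist X J x y + path_dist X J y z < top" and "0 < e"
  \<comment> \<open>Adding \<open>e / 2\<close> increases a distance strictly only when it is
    finite; the strict inequality yields a nearly optimal path.\<close>
  then have xy: "path_dist X J x y < path_dist X J x y + ennreal (e / 2)"
    and yz: "path_dist X J y z < path_dist X J y z + ennreal (e / 2)"
    by (simp_all add: ennreal_add_left_cancel_less[of _ 0, simplified] less_top)
  obtain N f where f: "f \<in> paths_between X J N x y" "path_len J 0 1 f < path_dist X J x y + ennreal (e / 2)"
    using xy by (rule path_dist_less)
  obtain M g where g: "g \<in> paths_between X J M y z" "path_len J 0 1 g < path_dist X J y z + ennreal (e / 2)"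
    using yz by (rule path_dist_less)
  obtain h where h: "h \<in> paths_between X J (N + M) x z"
    "path_len J 0 1 h = path_len J 0 1 f + path_len J 0 1 g"
    using concat_paths_between[OF assms f(1) g(1)] by blast
  have "path_dist X J x z \<le> path_len J 0 1 f + path_len J 0 1 g"
    using path_dist_le[OF h(1)] h(2) by simp
  also have "\<dots> \<le> (path_dist X J x y + ennreal (e / 2)) + (path_dist X J y z + ennreal (e / 2))"
    using f g by (intro add_mono) auto
  also have "\<dots> = path_dist X J x y + path_dist X J y z + (ennreal (e / 2) + ennreal (e / 2))"
    by (simp only: add_ac)
  also have "ennreal (e / 2) + ennreal (e / 2) = ennreal e"
    using \<open>0 < e\<close> by (simp flip: ennreal_plus)
  finally show "path_dist X J x z \<le> path_dist X J x y + path_dist X J y z + ennreal e" .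
qed

subsection \<open>Chains\<close>

text \<open>Here \<open>n\<close> counts steps and indices start at 0, whereas
  \<open>chain_dist\<close> counts points from 1. Case \<open>n = 0\<close> is the one-point chain
  with empty sum, and concatenation simply adds step counts.\<close>

definition chain_sums :: "'a set \<Rightarrow> ('a \<Rightarrow> 'a \<Rightarrow> real) \<Rightarrow> 'a \<Rightarrow> 'a \<Rightarrow> real set" where
  "chain_sums X J x y =
     {(\<Sum>i<n. J (c i) (c (Suc i))) | n c. (\<forall>i\<le>n. c i \<in> X) \<and> c 0 = x \<and> c n = y}"

lemma chain_sumsI:
  "(\<And>i. i \<le> n \<Longrightarrow> c i \<in> X) \<Longrightarrow> c 0 = x \<Longrightarrow> c n = y \<Longrightarrow>
    (\<Sum>i<n. J (c i) (c (Suc i))) \<in> chain_sums X J x y"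
  unfolding chain_sums_def by blast

lemma chain_sumsE:
  assumes "r \<in> chain_sums X J x y"
  obtains n c where "r = (\<Sum>i<n. J (c i) (c (Suc i)))" "\<And>i. i \<le> n \<Longrightarrow> c i \<in> X" "c 0 = x" "c n = y"
  using assms unfolding chain_sums_def by blast

lemma chain_dist_eq_Inf:
  fixes X :: "'a set"
  shows "chain_dist X J x y = Inf (chain_sums X J x y)"
proof -
  have "{(\<Sum>i=1..<n. J (c i) (c (i+1))) | (n :: nat) (c :: nat \<Rightarrow> 'a). 1 \<le> n \<and> (\<forall>i\<in>{1..n}. c i \<in> X) \<and> c 1 = x \<and> c n = y}
    = chain_sums X J x y" (is "?A = _")
  proof (intro subset_antisym subsetI)
    fix r assume "r \<in> ?A"
    then obtain n :: nat and c :: "nat \<Rightarrow> 'a" where n: "1 \<le> n" and r: "r = (\<Sum>i=1..<n. J (c i) (c (i+1)))"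
      and c: "\<forall>i\<in>{1..n}. c i \<in> X" "c 1 = x" "c n = y"
      by blast
    \<comment> \<open>A chain of \<open>n\<close> points has \<open>k = n - 1\<close> steps.\<close>
    obtain k where k: "n = Suc k" using n by (cases n) auto
    have "r = (\<Sum>i<k. J (c (Suc i)) (c (Suc (Suc i))))"
      unfolding r k using sum.shift_bounds_Suc_ivl[of "\<lambda>i. J (c i) (c (Suc i))" 0 k]
      by (simp only: One_nat_def lessThan_atLeast0 add_Suc_right add_0_right)
    also have "\<dots> \<in> chain_sums X J x y"
      using c k by (intro chain_sumsI[where c = "\<lambda>i. c (Suc i)"]) auto
    finally show "r \<in> chain_sums X J x y" .
  next
    fix r assume "r \<in> chain_sums X J x y"
    then obtain k c where r: "r = (\<Sum>i<k. J (c i) (c (Suc i)))"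
      and c: "\<And>i. i \<le> k \<Longrightarrow> c i \<in> X" "c 0 = x" "c k = y"
      by (rule chain_sumsE) (rule that)
    have "r = (\<Sum>i=1..<Suc k. J (c (i - 1)) (c (i + 1 - 1)))"
      using sum.shift_bounds_Suc_ivl[of "\<lambda>i. J (c (i - 1)) (c i)" 0 k] r
      by (simp add: lessThan_atLeast0)
    moreover have "\<forall>i\<in>{1..Suc k}. c (i - 1) \<in> X" using c(1) by auto
    ultimately show "r \<in> ?A"
      using c(2,3) by (intro CollectI exI[of _ "Suc k"] exI[of _ "\<lambda>i. c (i - 1)"]) simp
  qed
  then show ?thesis by (simp add: chain_dist_def)
qed

context
  fixes X :: "'a set" and J :: "'a \<Rightarrow> 'a \<Rightarrow> real"
  assumes q: "quasimetric_on X J"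
begin

lemma chain_sums_nonneg: "r \<in> chain_sums X J x y \<Longrightarrow> 0 \<le> r"
  by (erule chain_sumsE) (auto intro!: sum_nonneg quasimetric_onD(1)[OF q])

lemma chain_dist_le: "r \<in> chain_sums X J x y \<Longrightarrow> chain_dist X J x y \<le> r"
  unfolding chain_dist_eq_Inf
  by (intro cInf_lower bdd_belowI[of _ 0] chain_sums_nonneg)

text \<open>The single step from \<open>x\<close> to \<open>y\<close> is a chain. Without any chain,
  the real-valued \<open>Inf\<close> would carry no information.\<close>

lemma chain_sums_ne:
  assumes "x \<in> X" "y \<in> X"
  shows "chain_sums X J x y \<noteq> {}"
proof -
  define c where "c = (\<lambda>i::nat. if i = 0 then x else y)"
  have "(\<Sum>i<1. J (c i) (c (Suc i))) \<in> chain_sums X J x y"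
    using assms by (intro chain_sumsI) (simp_all add: c_def)
  then show ?thesis by blast
qed

lemma chain_dist_greatest:
  assumes "x \<in> X" "y \<in> X" "\<And>r. r \<in> chain_sums X J x y \<Longrightarrow> c \<le> r"
  shows "c \<le> chain_dist X J x y"
  unfolding chain_dist_eq_Inf by (rule cInf_greatest[OF chain_sums_ne[OF assms(1,2)] assms(3)])

lemma chain_sums_rev: "r \<in> chain_sums X J x y \<Longrightarrow> r \<in> chain_sums X J y x"
proof (erule chain_sumsE)
  fix n c assume r: "r = (\<Sum>i<n. J (c i) (c (Suc i)))" and c: "\<And>i. i \<le> n \<Longrightarrow> c i \<in> X" "c 0 = x" "c n = y"
  have "r = (\<Sum>i<n. J (c (n - Suc i)) (c (Suc (n - Suc i))))"
    unfolding r by (rule sum.nat_diff_reindex[symmetric])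
  also have "\<dots> = (\<Sum>i<n. J (c (n - i)) (c (n - Suc i)))"
    by (intro sum.cong refl) (simp add: Suc_diff_Suc quasimetric_onD(3)[OF q] c(1))
  also have "\<dots> \<in> chain_sums X J y x"
    using c by (intro chain_sumsI[where c = "\<lambda>i. c (n - i)"]) auto
  finally show ?thesis .
qed

lemma chain_sums_add:
  assumes "r \<in> chain_sums X J x y" "s \<in> chain_sums X J y z"
  shows "r + s \<in> chain_sums X J x z"
proof -
  obtain n c where r: "r = (\<Sum>i<n. J (c i) (c (Suc i)))" and c: "\<And>i. i \<le> n \<Longrightarrow> c i \<in> X" "c 0 = x" "c n = y"
    using assms(1) by (rule chain_sumsE) (rule that)
  obtain k d where s: "s = (\<Sum>i<k. J (d i) (d (Suc i)))" and d: "\<And>i. i \<le> k \<Longrightarrow> d i \<in> X" "d 0 = y" "d k = z"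
    using assms(2) by (rule chain_sumsE) (rule that)
  define w where "w = (\<lambda>i. if i \<le> n then c i else d (i - n))"
  \<comment> \<open>At \<open>i = 0\<close> this uses that the first chain ends where the second
    begins, at \<open>y\<close>.\<close>
  have w: "w (n + i) = d i" for i using c d by (auto simp: w_def)
  have "(\<Sum>i<n + k. J (w i) (w (Suc i))) = (\<Sum>i<n. J (w i) (w (Suc i))) + (\<Sum>i<k. J (w (n + i)) (w (n + Suc i)))"
    by (induction k) (simp_all add: add_ac)
  also have "(\<Sum>i<n. J (w i) (w (Suc i))) = r" by (simp add: r w_def)
  also have "(\<Sum>i<k. J (w (n + i)) (w (n + Suc i))) = s" by (simp only: s w)
  finally have "r + s = (\<Sum>i<n + k. J (w i) (w (Suc i)))" by simp
  also have "\<dots> \<in> chain_sums X J x z"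
    using c d w[of k] by (intro chain_sumsI) (auto simp: w_def)
  finally show ?thesis .
qed

text \<open>The partition points of any path form a chain whose sum is at most the length of the
  path. Through this comparison \<open>path_dist\<close> inherits the separation of points from
  \<open>chain_dist\<close>.\<close>

lemma chain_dist_le_path_dist:
  assumes "x \<in> X" "y \<in> X"
  shows "ennreal (chain_dist X J x y) \<le> path_dist X J x y"
proof (rule ccontr)
  assume "\<not> ?thesis"
  then have "path_dist X J x y < ennreal (chain_dist X J x y)" by simp
  then obtain N f where f: "f \<in> paths_between X J N x y" "path_len J 0 1 f < ennreal (chain_dist X J x y)"
    by (rule path_dist_less)
  obtain c where c: "\<forall>i\<le>N. c i \<in> X" "c 0 = x" "c N = y"
    and sum: "(\<Sum>i<N. ennreal (J (c i) (c (Suc i)))) \<le> path_len J 0 1 f"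
    using pw_lipschitz_maps_has_metric_speed(2)[of f X J 0 1 N] f(1) by (auto simp: paths_between_def)
  have "chain_dist X J x y \<le> (\<Sum>i<N. J (c i) (c (Suc i)))"
    using c by (intro chain_dist_le chain_sumsI) auto
  then have "ennreal (chain_dist X J x y) \<le> ennreal (\<Sum>i<N. J (c i) (c (Suc i)))"
    by (rule ennreal_leI)
  also have "\<dots> = (\<Sum>i<N. ennreal (J (c i) (c (Suc i))))"
    using c(1) by (intro sum_ennreal[symmetric]) (auto intro!: quasimetric_onD(1)[OF q])
  also note sum
  also note f(2)
  finally show False by simp
qed

end

section \<open>Ideal quasimetrics and the two metrics\<close>

lemma ideal_quasimetric_le_chain_dist:
  fixes X :: "'a set"
  assumes "ideal_quasimetric_on X J"
  obtains \<sigma> where "\<sigma> \<ge> 1" "\<And>x y. x \<in> X \<Longrightarrow> y \<in> X \<Longrightarrow> J x y \<le> \<sigma> * chain_dist X J x y"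
proof -
  have q: "quasimetric_on X J" using assms by (simp add: ideal_quasimetric_on_def)
  obtain \<sigma> where \<sigma>: "\<sigma> \<ge> 1" and id: "\<And>(n :: nat) (x :: nat \<Rightarrow> 'a). n \<ge> 1 \<Longrightarrow> (\<And>i. i \<in> {1..n+1} \<Longrightarrow> x i \<in> X) \<Longrightarrow>
        J (x 1) (x (n+1)) \<le> \<sigma> * (\<Sum>i=1..n. J (x i) (x (i+1)))"
    using assms unfolding ideal_quasimetric_on_def by blast
  have "J x y \<le> \<sigma> * chain_dist X J x y" if xy: "x \<in> X" "y \<in> X" for x y
  proof -
    \<comment> \<open>The ideal inequality bounds all chain sums below by the same number, so the
      bound passes to their infimum.\<close>
    have "J x y / \<sigma> \<le> r" if "r \<in> chain_sums X J x y" for r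
      using that
    proof (rule chain_sumsE)
      fix n c assume r: "r = (\<Sum>i<n. J (c i) (c (Suc i)))"
        and c: "\<And>i. i \<le> n \<Longrightarrow> c i \<in> X" "c 0 = x" "c n = y"
      have "J x y \<le> \<sigma> * r"
      \<comment> \<open>The ideal inequality is stated for at least one step. A chain without steps
        has \<open>x = y\<close>, where \<open>J x y\<close> vanishes.\<close>
      proof (cases n)
        case 0
        then show ?thesis using r c xy quasimetric_onD(2)[OF q xy] by simp
      next
        case (Suc k)
        \<comment> \<open>The ideal inequality numbers points from 1 and the chain from 0, hence the
          shift by \<open>i - 1\<close>.\<close>
        have "J (c (1 - 1)) (c (n + 1 - 1)) \<le> \<sigma> * (\<Sum>i=1..n. J (c (i - 1)) (c (i + 1 - 1)))"
          using c(1) Suc by (intro id[of n "\<lambda>i. c (i - 1)"]) auto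
        moreover have "(\<Sum>i=1..n. J (c (i - 1)) (c (i + 1 - 1))) = r"
          using sum.shift_bounds_Suc_ivl[of "\<lambda>i. J (c (i - 1)) (c i)" 0 n] r
          by (simp add: lessThan_atLeast0 atLeastLessThanSuc_atLeastAtMost)
        ultimately show ?thesis using c by simp
      qed
      then show ?thesis using \<sigma> by (simp add: divide_le_eq mult.commute)
    qed
    then have "J x y / \<sigma> \<le> chain_dist X J x y"
      by (rule chain_dist_greatest[OF q xy])
    then show ?thesis using \<sigma> by (simp add: divide_le_eq mult.commute)
  qed
  with \<sigma> show ?thesis by (rule that)
qed

lemma chain_dist_metric:
  assumes "ideal_quasimetric_on X J"
  shows "metric_on X (chain_dist X J)"
proof (rule metric_onI)
  have q: "quasimetric_on X J" using assms by (simp add: ideal_quasimetric_on_def)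
  obtain \<sigma> where \<sigma>: "\<sigma> \<ge> 1" and J_le: "\<And>x y. x \<in> X \<Longrightarrow> y \<in> X \<Longrightarrow> J x y \<le> \<sigma> * chain_dist X J x y"
    using ideal_quasimetric_le_chain_dist[OF assms] by blast
  fix x y assume x: "x \<in> X" and y: "y \<in> X"
  show nonneg: "0 \<le> chain_dist X J x y"
    by (rule chain_dist_greatest[OF q x y chain_sums_nonneg[OF q]])
  show "chain_dist X J x y = chain_dist X J y x"
    unfolding chain_dist_eq_Inf using chain_sums_rev[OF q] by (metis subsetI subset_antisym)
  show "chain_dist X J x y = 0 \<longleftrightarrow> x = y"
  proof
    assume "chain_dist X J x y = 0"
    then have "J x y = 0" using J_le[OF x y] quasimetric_onD(1)[OF q x y] by simp
    then show "x = y" using quasimetric_onD(2)[OF q x y] by simp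
  next
    assume "x = y"
    then have "0 \<in> chain_sums X J x y"
      using chain_sumsI[of 0 "\<lambda>_. x" X x y J] x by simp
    then show "chain_dist X J x y = 0"
      using chain_dist_le[OF q] nonneg by (metis order_antisym)
  qed
  fix z assume z: "z \<in> X"
  \<comment> \<open>The two infima are taken one after the other: first over chains from
    \<open>x\<close> to \<open>y\<close> with \<open>s\<close> fixed, then over the sums
    \<open>s\<close> of chains from \<open>y\<close> to \<open>z\<close>.\<close>
  have "chain_dist X J x z - s \<le> chain_dist X J x y" if s: "s \<in> chain_sums X J y z" for s
  proof (rule chain_dist_greatest[OF q x y])
    fix r assume "r \<in> chain_sums X J x y"
    then show "chain_dist X J x z - s \<le> r"
      using chain_dist_le[OF q chain_sums_add[OF q _ s]] by (simp add: diff_le_eq)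
  qed
  then have "chain_dist X J x z - chain_dist X J x y \<le> chain_dist X J y z"
    by (intro chain_dist_greatest[OF q y z]) (simp add: algebra_simps)
  then show "chain_dist X J x z \<le> chain_dist X J x y + chain_dist X J y z" by simp
qed

text \<open>\<open>enn2real\<close> sends infinity to 0. Finiteness therefore enters twice: a real
  value 0 then means that \<open>path_dist\<close> is 0, and monotonicity and additivity of
  \<open>enn2real\<close> apply in the triangle inequality.\<close>

lemma path_dist_metric:
  assumes J: "ideal_quasimetric_on X J"
    and fin: "\<And>x y. x \<in> X \<Longrightarrow> y \<in> X \<Longrightarrow> path_dist X J x y < \<infinity>"
  shows "metric_on X (\<lambda>x y. enn2real (path_dist X J x y))"
proof (rule metric_onI)
  have q: "quasimetric_on X J" using J by (simp add: ideal_quasimetric_on_def)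
  fix x y assume x: "x \<in> X" and y: "y \<in> X"
  show "0 \<le> enn2real (path_dist X J x y)" by simp
  show "enn2real (path_dist X J x y) = enn2real (path_dist X J y x)"
    using path_dist_sym_le[of X J x y] path_dist_sym_le[of X J y x] by simp
  show "enn2real (path_dist X J x y) = 0 \<longleftrightarrow> x = y"
  proof
    assume "enn2real (path_dist X J x y) = 0"
    then have "path_dist X J x y = 0" using fin[OF x y] by (auto simp: enn2real_eq_0_iff)
    \<comment> \<open>\<open>ennreal\<close> maps negative reals to 0, so at first only this
      inequality follows; nonnegativity of \<open>chain_dist\<close> turns it into equality.\<close>
    then have "chain_dist X J x y \<le> 0"
      using chain_dist_le_path_dist[OF q x y] by (simp add: ennreal_eq_0_iff)
    then show "x = y" using metric_onD(1,3)[OF chain_dist_metric[OF J] x y] by simp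
  next
    assume "x = y"
    then show "enn2real (path_dist X J x y) = 0" using path_dist_self[OF q x] by simp
  qed
  fix z assume z: "z \<in> X"
  have "enn2real (path_dist X J x z) \<le> enn2real (path_dist X J x y + path_dist X J y z)"
    using fin x y z by (intro enn2real_mono path_dist_triangle[OF q]) simp
  also have "\<dots> = enn2real (path_dist X J x y) + enn2real (path_dist X J y z)"
    using fin x y z by (intro enn2real_plus) simp_all
  finally show "enn2real (path_dist X J x z) \<le> enn2real (path_dist X J x y) + enn2real (path_dist X J y z)" .
qed

theorem lemma3p13:
  fixes X :: "'a set" and J :: "'a \<Rightarrow> 'a \<Rightarrow> real"
  assumes "X \<noteq> {}" and "ideal_quasimetric_on X J"
  shows "metric_on X (chain_dist X J) \<and>
         ((\<forall>x\<in>X. \<forall>y\<in>X. path_dist X J x y < \<infinity>) \<longrightarrow>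
            metric_on X (\<lambda>x y. enn2real (path_dist X J x y)))"
  using chain_dist_metric[OF assms(2)] path_dist_metric[OF assms(2)] by blast

end
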